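(* Let $a,c,y\in\mathbb{R}$ satisfy $c<0<a$, $2c+a<0$, $c<-a-c<a$ and $y\in[c,-a-c]$, let $\sigma>0$, and let $x_0$, $w_1,w_2$, the processes $\{x_n(t)\}_{t\ge0}$, $n\ge1$, and the functions $\gamma_n$, $n\ge1$, be as defined in the context. For $n\ge1$ let $$X^\sigma_n(t):=x_0(t)+\sigma x_1(t)+\cdots+\sigma^nx_n(t),\qquad \Gamma_n(t):=\sum_{i=1}^n\gamma_i(t),\qquad t\ge0.$$ Then, for any $n\ge 1$ and $T>0$, $$\mathbb{P}\Big(|X^\sigma_n(t)-x_0(t)|\le\Gamma_n(t)\ \text{for all } t\in[0,T]\Big)\ \ge\ 1-\sigma\,2^{(n-1)^+}\sqrt{2/\pi}\,\Big(\|w_1\|_{L^2([0,T])}+\|w_2\|_{L^2([0,T])}\Big),$$ where $(n-1)^+:=\max\{n-1,0\}$.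
   Context: $\{B(t)\}_{t\ge0}$ is a one-dimensional standard Brownian motion on a complete probability space $(\Omega,\mathcal{F},\mathbb{P})$. Set $\mathcal{K}(t,s):=w_2(t)w_1(s)-w_1(t)w_2(s)$ (with $w_1,w_2$ defined below), and $$x_1(t):=\int_0^t\mathcal{K}(t,s)\,dB(s)=w_2(t)\int_0^tw_1(s)\,dB(s)-w_1(t)\int_0^tw_2(s)\,dB(s),$$ $$x_n(t):=\int_0^t\mathcal{K}(t,s)\Big(\sum_{j=1}^{n-1}x_j(s)x_{n-j}(s)\Big)ds,\quad n\ge2.$$ Equivalently, $x_1$ solves $\ddot x_1=2x_0x_1+\dot B$ and $x_n$ ($n\ge2$) solves $\ddot x_n=2x_0x_n+\sum_{j=1}^{n-1}x_jx_{n-j}$, all with zero initial position and velocity. The functions $\gamma_n$ are defined recursively by $\gamma_1(t):=|w_1(t)|+|w_2(t)|$ and, for $n\ge2$, $\gamma_n(t):=\int_0^t|\mathcal{K}(t,s)|\big(\sum_{j=1}^{n-1}\gamma_j(s)\gamma_{n-j}(s)\big)ds$, $t\ge0$. Let $q:=\sqrt{\frac{2c+a}{c-a}}\in(0,1)$, $F(\gamma,q):=\int_0^\gamma\frac{d\alpha}{\sqrt{1-q^2\sin^2\alpha}}$, $i_y:=F\big(\arcsin\sqrt{\frac{c-y}{2c+a}},q\big)$, and let $\mathrm{sn},\mathrm{cn},\mathrm{dn}$ be the Jacobi elliptic functions (second argument = modulus $q$). Set $$x_0(t):=c-(a+2c)\,\mathrm{sn}^2\Big(\sqrt{\tfrac{a-c}{6}}\,t+i_y,q\Big).$$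 Let $\mathcal{E}(t,q):=\int_0^t\mathrm{dn}^2(s,q)\,ds$ (Jacobi's Epsilon function) and $$u_1(t):=\mathrm{sn}(t,q)\,\mathrm{cn}(t,q)\,\mathrm{dn}(t,q),$$ $$u_2(t):=\alpha_0+\alpha_1\mathrm{cn}^2(t,q)+\alpha_2\mathrm{cn}^4(t,q)+\big(\beta_0t+\beta_1\mathcal{E}(t,q)\big)u_1(t),$$ with $\alpha_0=-1+q^2$, $\alpha_1=-2q^6+3q^4-5q^2+2$, $\alpha_2=2q^2(q^4-q^2+1)$, $\beta_0=-q^4+3q^2-2$, $\beta_1=2(q^4-q^2+1)$. The functions $w_i(t):=\kappa_i\,u_i\big(\sqrt{\tfrac{a-c}{6}}\,t+i_y\big)$, $i=1,2$, where $\kappa_1,\kappa_2$ are fixed nonzero real constants chosen so that the Wronskian is normalized, $w_1\dot w_2-\dot w_1w_2=1$, are two linearly independent solutions of $\ddot w(t)-2x_0(t)w(t)=0$. *)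

theory Defs
  imports "HOL-Probability.Probability"
begin

section \<open>Jacobi elliptic functions of modulus \<open>q\<close>\<close>

definition elliptic_F :: "real \<Rightarrow> real \<Rightarrow> real" where
  "elliptic_F \<gamma> q = (LBINT \<alpha>=0..\<gamma>. 1 / sqrt (1 - q\<^sup>2 * (sin \<alpha>)\<^sup>2))"

text \<open>For \<open>0 \<le> q < 1\<close> the map \<open>\<lambda>\<phi>. elliptic_F \<phi> q\<close> is an increasing bijection of the reals
  (the interval integral is oriented, so negative amplitudes are covered); the amplitude is its
  inverse.\<close>

definition jacobi_am :: "real \<Rightarrow> real \<Rightarrow> real" where
  "jacobi_am t q = (THE \<phi>. elliptic_F \<phi> q = t)"

definition jacobi_sn :: "real \<Rightarrow> real \<Rightarrow> real" where
  "jacobi_sn t q = sin (jacobi_am t q)"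

definition jacobi_cn :: "real \<Rightarrow> real \<Rightarrow> real" where
  "jacobi_cn t q = cos (jacobi_am t q)"

definition jacobi_dn :: "real \<Rightarrow> real \<Rightarrow> real" where
  "jacobi_dn t q = sqrt (1 - q\<^sup>2 * (jacobi_sn t q)\<^sup>2)"

definition jacobi_Epsilon :: "real \<Rightarrow> real \<Rightarrow> real" where
  "jacobi_Epsilon t q = (LBINT s=0..t. (jacobi_dn s q)\<^sup>2)"


section \<open>The deterministic path and the linearised equation\<close>

definition modulus :: "real \<Rightarrow> real \<Rightarrow> real" where
  "modulus a c = sqrt ((2 * c + a) / (c - a))"

definition phase :: "real \<Rightarrow> real \<Rightarrow> real \<Rightarrow> real" where
  "phase a c y = elliptic_F (arcsin (sqrt ((c - y) / (2 * c + a)))) (modulus a c)"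

text \<open>The common argument \<open>sqrt ((a - c) / 6) * t + i\<^sub>y\<close> of all the elliptic functions.\<close>

definition arg_y :: "real \<Rightarrow> real \<Rightarrow> real \<Rightarrow> real \<Rightarrow> real" where
  "arg_y a c y t = sqrt ((a - c) / 6) * t + phase a c y"

definition x_zero :: "real \<Rightarrow> real \<Rightarrow> real \<Rightarrow> real \<Rightarrow> real" where
  "x_zero a c y t = c - (a + 2 * c) * (jacobi_sn (arg_y a c y t) (modulus a c))\<^sup>2"

definition u_one :: "real \<Rightarrow> real \<Rightarrow> real" where
  "u_one q t = jacobi_sn t q * jacobi_cn t q * jacobi_dn t q"

definition u_two :: "real \<Rightarrow> real \<Rightarrow> real" where
  "u_two q t =
     (let \<alpha>0 = - 1 + q ^ 2;
          \<alpha>1 = - 2 * q ^ 6 + 3 * q ^ 4 - 5 * q ^ 2 + 2;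
          \<alpha>2 = 2 * q ^ 2 * (q ^ 4 - q ^ 2 + 1);
          \<beta>0 = - (q ^ 4) + 3 * q ^ 2 - 2;
          \<beta>1 = 2 * (q ^ 4 - q ^ 2 + 1)
      in \<alpha>0 + \<alpha>1 * (jacobi_cn t q) ^ 2 + \<alpha>2 * (jacobi_cn t q) ^ 4
         + (\<beta>0 * t + \<beta>1 * jacobi_Epsilon t q) * u_one q t)"

definition w_one :: "real \<Rightarrow> real \<Rightarrow> real \<Rightarrow> real \<Rightarrow> real \<Rightarrow> real" where
  "w_one a c y \<kappa>1 t = \<kappa>1 * u_one (modulus a c) (arg_y a c y t)"

definition w_two :: "real \<Rightarrow> real \<Rightarrow> real \<Rightarrow> real \<Rightarrow> real \<Rightarrow> real" where
  "w_two a c y \<kappa>2 t = \<kappa>2 * u_two (modulus a c) (arg_y a c y t)"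

definition kernel_K :: "(real \<Rightarrow> real) \<Rightarrow> (real \<Rightarrow> real) \<Rightarrow> real \<Rightarrow> real \<Rightarrow> real" where
  "kernel_K w1 w2 t s = w2 t * w1 s - w1 t * w2 s"

definition L2_norm_on :: "real \<Rightarrow> (real \<Rightarrow> real) \<Rightarrow> real" where
  "L2_norm_on T f = sqrt (LBINT s:{0..T}. (f s)\<^sup>2)"


section \<open>Brownian motion and the stochastic integral of deterministic integrands\<close>

definition brownian_motion :: "'a measure \<Rightarrow> (real \<Rightarrow> 'a \<Rightarrow> real) \<Rightarrow> bool" where
  "brownian_motion M B \<longleftrightarrow>
     prob_space M \<and>
     (\<forall>t\<ge>0. B t \<in> borel_measurable M) \<and>
     (AE \<omega> in M. B 0 \<omega> = 0) \<and>
     (\<forall>(p :: nat \<Rightarrow> real) N. 0 \<le> p 0 \<and> (\<forall>i<N. p i \<le> p (Suc i)) \<longrightarrow>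
        prob_space.indep_vars M (\<lambda>_. borel) (\<lambda>i \<omega>. B (p (Suc i)) \<omega> - B (p i) \<omega>) {..<N}) \<and>
     (\<forall>s t. 0 \<le> s \<and> s < t \<longrightarrow>
        distributed M lborel (\<lambda>\<omega>. B t \<omega> - B s \<omega>) (normal_density 0 (sqrt (t - s)))) \<and>
     (AE \<omega> in M. continuous_on {0..} (\<lambda>t. B t \<omega>))"

text \<open>A step function on \<open>{0..t}\<close> is given by a partition \<open>0 = p 0 \<le> \<dots> \<le> p N = t\<close> and its
  values \<open>v i\<close> on \<open>{p i<..p (Suc i)}\<close>.\<close>

definition is_partition :: "real \<Rightarrow> nat \<Rightarrow> (nat \<Rightarrow> real) \<Rightarrow> bool" where
  "is_partition t N p \<longleftrightarrow> p 0 = 0 \<and> p N = t \<and> (\<forall>i<N. p i \<le> p (Suc i))"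

definition step_fun :: "nat \<Rightarrow> (nat \<Rightarrow> real) \<Rightarrow> (nat \<Rightarrow> real) \<Rightarrow> real \<Rightarrow> real" where
  "step_fun N p v s = (\<Sum>i<N. v i * indicator {p i<..p (Suc i)} s)"

definition step_integral ::
    "(real \<Rightarrow> 'a \<Rightarrow> real) \<Rightarrow> nat \<Rightarrow> (nat \<Rightarrow> real) \<Rightarrow> (nat \<Rightarrow> real) \<Rightarrow> 'a \<Rightarrow> real" where
  "step_integral B N p v \<omega> = (\<Sum>i<N. v i * (B (p (Suc i)) \<omega> - B (p i) \<omega>))"

text \<open>\<open>J\<close> is an \<open>L\<^sup>2\<close> limit of the integrals of step functions that approximate \<open>f\<close> in
  \<open>L\<^sup>2([0,t])\<close>. By the isometry the limit does not depend, up to null sets, on the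
  approximating sequence. Distances are nonnegative integrals, so that divergent integrals do not
  count as 0.\<close>

definition is_stoch_integral ::
    "'a measure \<Rightarrow> (real \<Rightarrow> 'a \<Rightarrow> real) \<Rightarrow> (real \<Rightarrow> real) \<Rightarrow> real \<Rightarrow> ('a \<Rightarrow> real) \<Rightarrow> bool" where
  "is_stoch_integral M B f t J \<longleftrightarrow>
     J \<in> borel_measurable M \<and>
     (\<exists>(N :: nat \<Rightarrow> nat) (p :: nat \<Rightarrow> nat \<Rightarrow> real) (v :: nat \<Rightarrow> nat \<Rightarrow> real).
        (\<forall>k. is_partition t (N k) (p k)) \<and>
        (\<lambda>k. \<integral>\<^sup>+ s\<in>{0..t}. ennreal ((f s - step_fun (N k) (p k) (v k) s)\<^sup>2) \<partial>lborel) \<longlonglongrightarrow> 0 \<and>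
        (\<lambda>k. \<integral>\<^sup>+ \<omega>. ennreal ((J \<omega> - step_integral B (N k) (p k) (v k) \<omega>)\<^sup>2) \<partial>M) \<longlonglongrightarrow> 0)"

text \<open>\<open>I\<close> is a continuous version of the process \<open>t \<mapsto> \<integral>\<^sub>0\<^sup>t f dB\<close>, \<open>t \<ge> 0\<close>; it is unique up to
  indistinguishability.\<close>

definition stoch_integral_process ::
    "'a measure \<Rightarrow> (real \<Rightarrow> 'a \<Rightarrow> real) \<Rightarrow> (real \<Rightarrow> real) \<Rightarrow> (real \<Rightarrow> 'a \<Rightarrow> real) \<Rightarrow> bool" where
  "stoch_integral_process M B f I \<longleftrightarrow>
     (\<forall>t\<ge>0. is_stoch_integral M B f t (I t)) \<and>
     (AE \<omega> in M. continuous_on {0..} (\<lambda>t. I t \<omega>))"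


section \<open>The expansion coefficients and their bounds\<close>

text \<open>In \<open>x_proc\<close>, \<open>I1\<close> and \<open>I2\<close> are the processes \<open>\<integral>\<^sub>0\<^sup>t w1 dB\<close> and \<open>\<integral>\<^sub>0\<^sup>t w2 dB\<close>. The recursion for
  \<open>n \<ge> 2\<close> only involves the indices \<open>1, \<dots>, n - 1\<close>.\<close>

fun x_proc ::
    "(real \<Rightarrow> real) \<Rightarrow> (real \<Rightarrow> real) \<Rightarrow> (real \<Rightarrow> real) \<Rightarrow> (real \<Rightarrow> 'a \<Rightarrow> real) \<Rightarrow> (real \<Rightarrow> 'a \<Rightarrow> real) \<Rightarrow>
     nat \<Rightarrow> real \<Rightarrow> 'a \<Rightarrow> real" where
  "x_proc x0 w1 w2 I1 I2 0 t \<omega> = x0 t"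
| "x_proc x0 w1 w2 I1 I2 (Suc 0) t \<omega> = w2 t * I1 t \<omega> - w1 t * I2 t \<omega>"
| "x_proc x0 w1 w2 I1 I2 (Suc (Suc m)) t \<omega> =
     (LBINT s=0..t. kernel_K w1 w2 t s *
        (\<Sum>j=1..Suc m. x_proc x0 w1 w2 I1 I2 j s \<omega> * x_proc x0 w1 w2 I1 I2 (Suc (Suc m) - j) s \<omega>))"

text \<open>The value at index 0 is a dummy.\<close>

fun gamma_fun :: "(real \<Rightarrow> real) \<Rightarrow> (real \<Rightarrow> real) \<Rightarrow> nat \<Rightarrow> real \<Rightarrow> real" where
  "gamma_fun w1 w2 0 t = 0"
| "gamma_fun w1 w2 (Suc 0) t = \<bar>w1 t\<bar> + \<bar>w2 t\<bar>"
| "gamma_fun w1 w2 (Suc (Suc m)) t =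
     (LBINT s=0..t. \<bar>kernel_K w1 w2 t s\<bar> *
        (\<Sum>j=1..Suc m. gamma_fun w1 w2 j s * gamma_fun w1 w2 (Suc (Suc m) - j) s))"

definition X_approx ::
    "(real \<Rightarrow> real) \<Rightarrow> (real \<Rightarrow> real) \<Rightarrow> (real \<Rightarrow> real) \<Rightarrow> (real \<Rightarrow> 'a \<Rightarrow> real) \<Rightarrow> (real \<Rightarrow> 'a \<Rightarrow> real) \<Rightarrow>
     real \<Rightarrow> nat \<Rightarrow> real \<Rightarrow> 'a \<Rightarrow> real" where
  "X_approx x0 w1 w2 I1 I2 \<sigma> n t \<omega> = (\<Sum>i=0..n. \<sigma> ^ i * x_proc x0 w1 w2 I1 I2 i t \<omega>)"

definition Gamma_sum :: "(real \<Rightarrow> real) \<Rightarrow> (real \<Rightarrow> real) \<Rightarrow> nat \<Rightarrow> real \<Rightarrow> real" where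
  "Gamma_sum w1 w2 n t = (\<Sum>i=1..n. gamma_fun w1 w2 i t)"

end

theory Submission
  imports Defs
begin

text \<open>
  The proof has a pathwise and a probabilistic half.

  Pathwise, suppose that \<open>I1 = \<integral> w1 dB\<close> and \<open>I2 = \<integral> w2 dB\<close> are bounded by \<open>1 / \<sigma>\<close> on \<open>{0..T}\<close>. Then
  \<open>\<bar>x\<^sub>1\<bar> \<le> \<gamma>\<^sub>1 / \<sigma>\<close>, and since the recursion is homogeneous, \<open>\<sigma> ^ i * \<bar>x\<^sub>i\<bar> \<le> \<gamma>\<^sub>i\<close> for all \<open>i\<close>
  (\<open>x_proc_le_gamma_fun\<close>). Summation gives the event (\<open>X_approx_le_Gamma_sum\<close>).

  Probabilistically, each \<open>I\<^sub>i\<close> is a continuous martingale, so Doob's maximal inequality and the Gaussian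
  first moment give
  \<open>P(sup \<bar>I\<^sub>i\<bar> > 1 / \<sigma>) \<le> \<sigma> * E \<bar>I\<^sub>i(T)\<bar> = \<sigma> * sqrt (2 / pi) * \<parallel>w\<^sub>i\<parallel>\<close>
  (\<open>stoch_integral_maximal_inequality\<close>); as \<open>2 ^ (n - 1) \<ge> 1\<close>, the sum of the two bounds yields the claim.
  The martingale theory is reduced to finite sums of independent variables: Doob's inequality holds for
  step integrals (\<open>indep_sums_maximal_inequality\<close>), whose first moments are explicit
  (\<open>expectation_abs_step_integral\<close>), and it passes to \<open>I\<^sub>i\<close> on a finite grid of times by the Ito isometry
  (\<open>stoch_integral_step_distance\<close>) and from dyadic grids to all times by path continuity.

  Two regularity facts support this. The functions \<open>w1\<close> and \<open>w2\<close> are continuous, because the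
  amplitude is the inverse of a function whose slope is at least 1. The event is measurable, because
  outside a null set it is determined by continuous paths (\<open>X_approx_event_measurable\<close>).
\<close>

section \<open>Integrals with a variable endpoint\<close>

lemma interval_integrable_continuous_UNIV:
  fixes f :: "real \<Rightarrow> real"
  assumes "continuous_on UNIV f"
  shows "interval_lebesgue_integrable lborel (ereal a) (ereal b) f"
  using assms by (intro interval_integrable_isCont) (auto simp: continuous_on_eq_continuous_at)

lemma interval_integral_diff_endpoint:
  fixes f :: "real \<Rightarrow> real" and a b :: real
  assumes "continuous_on UNIV f"
  shows "(LBINT x=0..b. f x) - (LBINT x=0..a. f x) = (LBINT x=a..b. f x)"
proof -
  have "interval_lebesgue_integrable lborel (ereal (min 0 (min a b))) (ereal (max 0 (max a b))) f"
    by (rule interval_integrable_continuous_UNIV[OF assms])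
  then have "interval_lebesgue_integrable lborel (min 0 (min (ereal a) (ereal b)))
      (max 0 (max (ereal a) (ereal b))) f"
    by (simp add: zero_ereal_def max_def min_def split: if_splits)
  from interval_integral_sum[OF this] show ?thesis
    by simp
qed

text \<open>The substitution \<open>s = t * r\<close> moves the variable endpoint into the integrand. It is valid for
  both signs of \<open>t\<close>, because the interval integral is oriented, so that continuity in \<open>t\<close> can be
  proved on the whole line without a boundary point at \<open>0\<close>.\<close>
lemma volterra_substitution:
  fixes f :: "real \<Rightarrow> real" and t :: real
  assumes "continuous_on UNIV f"
  shows "(LBINT s=0..t. f s) = integral {0..1} (\<lambda>r. t * f (t * r))"
proof -
  have cf: "continuous_on A (\<lambda>r. f (t * r))" for A
    by (rule continuous_on_compose2[OF assms]) (auto intro!: continuous_intros)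
  have "(LBINT s=0..t. f s) = (LBINT s=t * 0..t * 1. f s)"
    by (simp add: zero_ereal_def)
  also have "\<dots> = (LBINT r=0..1. t *\<^sub>R f (t * r))"
    using interval_integral_substitution_finite[of 0 1 "\<lambda>r. t * r" "\<lambda>_. t" f]
    by (simp add: continuous_on_subset[OF assms] zero_ereal_def one_ereal_def)
  also have "\<dots> = integral {0..1} (\<lambda>r. t *\<^sub>R f (t * r))"
    unfolding zero_ereal_def one_ereal_def
    by (rule interval_integral_eq_integral)
      (auto intro!: borel_integrable_atLeastAtMost' continuous_intros cf)
  finally show ?thesis by simp
qed

lemma continuous_on_volterra:
  fixes k :: "real \<Rightarrow> real \<Rightarrow> real"
  assumes k: "continuous_on UNIV (\<lambda>(t, s). k t s)"
  shows "continuous_on UNIV (\<lambda>t. LBINT s=0..t. k t s)"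
proof -
  have ck: "continuous_on A (\<lambda>x. k (f x) (g x))"
    if "continuous_on A f" "continuous_on A g" for A :: "'c::topological_space set" and f g
    using continuous_on_compose2[OF k, of A "\<lambda>x. (f x, g x)"] that
    by (auto intro: continuous_on_Pair)
  have "(\<lambda>t. LBINT s=0..t. k t s) = (\<lambda>t. integral {0..1} (\<lambda>r. t * k t (t * r)))"
    by (intro ext volterra_substitution ck continuous_intros)
  moreover have "continuous_on UNIV (\<lambda>t. integral (cbox 0 1) (\<lambda>r. t * k t (t * r)))"
    by (rule integral_continuous_on_param) (auto simp: split_def intro!: continuous_intros ck)
  ultimately show ?thesis unfolding cbox_interval by metis
qed

lemma continuous_on_indefinite_integral:
  fixes f :: "real \<Rightarrow> real"
  assumes "continuous_on UNIV f"
  shows "continuous_on UNIV (\<lambda>t::real. LBINT s=0..t. f s)"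
  by (rule continuous_on_volterra, unfold split_def, rule continuous_on_compose2[OF assms])
    (auto intro: continuous_intros)

section \<open>Continuity of the Jacobi functions and of the fundamental solutions\<close>

lemma elliptic_integrand:
  fixes q :: real
  assumes "0 \<le> q" "q < 1"
  shows "continuous_on UNIV (\<lambda>\<alpha>. 1 / sqrt (1 - q\<^sup>2 * (sin \<alpha>)\<^sup>2))"
    and "1 \<le> 1 / sqrt (1 - q\<^sup>2 * (sin \<alpha>)\<^sup>2)"
proof -
  have *: "0 < 1 - q\<^sup>2 * (sin x)\<^sup>2" "1 - q\<^sup>2 * (sin x)\<^sup>2 \<le> 1" for x
  proof -
    have "q\<^sup>2 < 1" using assms by (simp add: abs_square_less_1)
    moreover have "(sin x)\<^sup>2 \<le> 1" by (simp add: abs_square_le_1)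
    ultimately have "q\<^sup>2 * (sin x)\<^sup>2 \<le> q\<^sup>2 * 1" by (intro mult_left_mono) auto
    with \<open>q\<^sup>2 < 1\<close> show "0 < 1 - q\<^sup>2 * (sin x)\<^sup>2" by simp
  qed auto
  show "continuous_on UNIV (\<lambda>\<alpha>. 1 / sqrt (1 - q\<^sup>2 * (sin \<alpha>)\<^sup>2))"
    by (intro continuous_intros) (use *(1) in \<open>auto simp: less_le\<close>)
  show "1 \<le> 1 / sqrt (1 - q\<^sup>2 * (sin \<alpha>)\<^sup>2)"
    using *[of \<alpha>] by simp
qed

text \<open>The integrand of \<^const>\<open>elliptic_F\<close> is at least 1, so amplitudes never get closer under
  \<^const>\<open>elliptic_F\<close>. This one inequality gives injectivity, surjectivity (with the intermediate value
  theorem), and that the inverse \<^const>\<open>jacobi_am\<close> is 1-Lipschitz.\<close>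
lemma elliptic_F_expands:
  assumes q: "0 \<le> q" "q < 1" and "a \<le> b"
  shows "b - a \<le> elliptic_F b q - elliptic_F a q"
proof -
  let ?f = "\<lambda>\<alpha>. 1 / sqrt (1 - q\<^sup>2 * (sin \<alpha>)\<^sup>2)"
  have int: "set_integrable lborel {a..b} ?f" "set_integrable lborel {a..b} (\<lambda>_. 1::real)"
    by (auto intro!: borel_integrable_atLeastAtMost' continuous_on_subset[OF elliptic_integrand(1)[OF q]])
  have "b - a = (LBINT \<alpha>:{a..b}. 1)"
    using \<open>a \<le> b\<close> by (simp add: set_lebesgue_integral_def)
  also have "\<dots> \<le> (LBINT \<alpha>:{a..b}. ?f \<alpha>)"
    by (rule set_integral_mono) (use int elliptic_integrand(2)[OF q] in auto)
  also have "\<dots> = elliptic_F b q - elliptic_F a q"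
    unfolding elliptic_F_def interval_integral_diff_endpoint[OF elliptic_integrand(1)[OF q]]
    using \<open>a \<le> b\<close> by (simp add: interval_integral_Icc)
  finally show ?thesis .
qed

text \<open>The definite description in \<^const>\<open>jacobi_am\<close> is meaningful: \<^const>\<open>elliptic_F\<close> takes every real value
  exactly once.\<close>
lemma elliptic_F_jacobi_am:
  assumes q: "0 \<le> q" "q < 1"
  shows "elliptic_F (jacobi_am t q) q = t"
proof -
  have F0: "elliptic_F 0 q = 0"
    by (simp add: elliptic_F_def zero_ereal_def)
  have "continuous_on UNIV (\<lambda>\<phi>. elliptic_F \<phi> q)"
    unfolding elliptic_F_def
    by (rule continuous_on_indefinite_integral[OF elliptic_integrand(1)[OF q]])
  then have "\<exists>\<phi>\<ge>-\<bar>t\<bar>. \<phi> \<le> \<bar>t\<bar> \<and> elliptic_F \<phi> q = t"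
    using elliptic_F_expands[OF q, of 0 "\<bar>t\<bar>"] elliptic_F_expands[OF q, of "-\<bar>t\<bar>" 0] F0
    by (intro IVT') (auto intro: continuous_on_subset)
  then obtain \<phi> where \<phi>: "elliptic_F \<phi> q = t" by blast
  have "\<phi>' = \<phi>" if "elliptic_F \<phi>' q = t" for \<phi>'
    using elliptic_F_expands[OF q, of \<phi> \<phi>'] elliptic_F_expands[OF q, of \<phi>' \<phi>] that \<phi>
    by linarith
  with \<phi> show ?thesis
    unfolding jacobi_am_def by (rule theI)
qed

lemma continuous_on_jacobi_am:
  assumes q: "0 \<le> q" "q < 1"
  shows "continuous_on UNIV (\<lambda>t. jacobi_am t q)"
proof -
  have "dist (jacobi_am s q) (jacobi_am t q) \<le> dist s t" for s t
    using elliptic_F_expands[OF q, of "jacobi_am s q" "jacobi_am t q"]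
      elliptic_F_expands[OF q, of "jacobi_am t q" "jacobi_am s q"]
    unfolding elliptic_F_jacobi_am[OF q] dist_real_def by linarith
  then show ?thesis
    unfolding continuous_on_iff by (meson order_le_less_trans)
qed

lemma continuous_on_u_one_u_two:
  assumes q: "0 \<le> q" "q < 1"
  shows "continuous_on UNIV (u_one q)" "continuous_on UNIV (u_two q)"
proof -
  note am = continuous_on_jacobi_am[OF q]
  have sn: "continuous_on UNIV (\<lambda>t. jacobi_sn t q)" and cn: "continuous_on UNIV (\<lambda>t. jacobi_cn t q)"
    unfolding jacobi_sn_def jacobi_cn_def by (intro continuous_intros am)+
  then have dn: "continuous_on UNIV (\<lambda>t. jacobi_dn t q)"
    unfolding jacobi_dn_def by (intro continuous_intros)
  then have "continuous_on UNIV (\<lambda>t. jacobi_Epsilon t q)"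
    unfolding jacobi_Epsilon_def
    by (intro continuous_on_indefinite_integral continuous_intros)
  moreover show u: "continuous_on UNIV (u_one q)"
    unfolding u_one_def by (intro continuous_intros sn cn dn)
  ultimately show "continuous_on UNIV (u_two q)"
    unfolding u_two_def Let_def by (intro continuous_intros cn)
qed

lemma continuous_on_w_one_w_two:
  assumes q: "0 \<le> modulus a c" "modulus a c < 1"
  shows "continuous_on UNIV (w_one a c y \<kappa>)" "continuous_on UNIV (w_two a c y \<kappa>)"
  unfolding w_one_def w_two_def arg_y_def
  by (intro continuous_intros continuous_on_compose2[OF continuous_on_u_one_u_two(1)[OF q]]
      continuous_on_compose2[OF continuous_on_u_one_u_two(2)[OF q]]; simp)+

text \<open>With both \<open>2 * c + a\<close> and \<open>c - a\<close> negative, the quotient is below 1 exactly if \<open>- a - c < a\<close>.\<close>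
lemma modulus_in_unit_interval:
  assumes "2 * c + a < 0" "- a - c < a"
  shows "0 \<le> modulus a c" "modulus a c < 1"
proof -
  have "0 \<le> (2 * c + a) / (c - a)" "(2 * c + a) / (c - a) < 1"
    using assms by (auto simp: divide_simps)
  then show "0 \<le> modulus a c" "modulus a c < 1"
    unfolding modulus_def by (auto simp: real_sqrt_lt_1_iff)
qed

section \<open>Pathwise bounds for the expansion coefficients\<close>

lemma continuous_on_kernel:
  assumes "continuous_on UNIV w1" "continuous_on UNIV w2"
    and "continuous_on A f" "continuous_on A g"
  shows "continuous_on A (\<lambda>x. kernel_K w1 w2 (f x) (g x))"
  unfolding kernel_K_def
  by (intro continuous_intros continuous_on_compose2[OF assms(1)] continuous_on_compose2[OF assms(2)] assms)
    auto

text \<open>An integral of a function that is not integrable is 0 by convention, and the bound of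
  \<^const>\<open>x_proc\<close> by \<^const>\<open>gamma_fun\<close> could then fail; continuity excludes this.\<close>
lemma continuous_on_gamma_fun:
  assumes w: "continuous_on UNIV w1" "continuous_on UNIV w2"
  shows "continuous_on UNIV (gamma_fun w1 w2 n)"
proof (induction n rule: less_induct)
  case (less n)
  consider "n = 0" | "n = Suc 0" | m where "n = Suc (Suc m)"
    by (metis not0_implies_Suc)
  then show ?case
  proof cases
    case 1
    then have "gamma_fun w1 w2 n = (\<lambda>_. 0)" by (simp add: fun_eq_iff)
    then show ?thesis by simp
  next
    case 2
    then have "gamma_fun w1 w2 n = (\<lambda>t. \<bar>w1 t\<bar> + \<bar>w2 t\<bar>)" by (simp add: fun_eq_iff)
    then show ?thesis by (auto intro!: continuous_intros w)
  next
    case 3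
    have IH: "continuous_on UNIV (\<lambda>p::real\<times>real. gamma_fun w1 w2 j (snd p))" if "j < n" for j
      using less.IH[OF that] by (rule continuous_on_compose2) (auto intro: continuous_intros)
    have "continuous_on UNIV (\<lambda>t. LBINT s=0..t. \<bar>kernel_K w1 w2 t s\<bar> *
        (\<Sum>j=1..Suc m. gamma_fun w1 w2 j s * gamma_fun w1 w2 (Suc (Suc m) - j) s))"
      by (rule continuous_on_volterra, unfold split_def,
          intro continuous_intros continuous_on_kernel[OF w] IH) (auto simp: 3)
    moreover have "gamma_fun w1 w2 n = (\<lambda>t. LBINT s=0..t. \<bar>kernel_K w1 w2 t s\<bar> *
        (\<Sum>j=1..Suc m. gamma_fun w1 w2 j s * gamma_fun w1 w2 (Suc (Suc m) - j) s))"
      by (simp add: fun_eq_iff 3 del: sum.cl_ivl_Suc)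
    ultimately show ?thesis by simp
  qed
qed

lemma interval_integral_zero_nonneg:
  fixes f :: "real \<Rightarrow> real" and t :: real
  assumes "0 \<le> t" "\<And>s. 0 \<le> s \<Longrightarrow> s \<le> t \<Longrightarrow> 0 \<le> f s"
  shows "0 \<le> (LBINT s=0..t. f s)"
  using assms unfolding zero_ereal_def
  by (auto simp: interval_integral_Icc set_lebesgue_integral_def intro!: integral_nonneg_AE split: split_indicator)

lemma gamma_fun_nonneg: "0 \<le> t \<Longrightarrow> 0 \<le> gamma_fun w1 w2 n t"
proof (induction n arbitrary: t rule: less_induct)
  case (less n)
  consider "n = 0" | "n = Suc 0" | m where "n = Suc (Suc m)"
    by (metis not0_implies_Suc)
  then show ?case
  proof cases
    case 3
    show ?thesis
      unfolding 3 gamma_fun.simps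
      by (intro interval_integral_zero_nonneg mult_nonneg_nonneg sum_nonneg less) (auto simp: 3)
  qed auto
qed

text \<open>If \<open>f\<close> is not integrable, its integral is 0 by convention, and the bound holds because \<open>g\<close> is
  nonnegative on the interval.\<close>
lemma abs_interval_integral_le:
  fixes f g :: "real \<Rightarrow> real" and t :: real
  assumes "0 \<le> t" and g: "continuous_on UNIV g" and le: "\<And>s. 0 \<le> s \<Longrightarrow> s \<le> t \<Longrightarrow> \<bar>f s\<bar> \<le> g s"
  shows "\<bar>LBINT s=0..t. f s\<bar> \<le> (LBINT s=0..t. g s)"
proof -
  have "integrable lborel (\<lambda>s. indicator {0..t} s *\<^sub>R g s)"
    using borel_integrable_atLeastAtMost'[OF continuous_on_subset[OF g], of 0 t]
    by (simp add: set_integrable_def)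
  then have "(LINT s|lborel. \<bar>indicator {0..t} s *\<^sub>R f s\<bar>) \<le> (LINT s|lborel. indicator {0..t} s *\<^sub>R g s)"
    using le by (intro integral_mono') (auto split: split_indicator intro: order_trans[OF abs_ge_zero])
  with integral_abs_bound[of lborel "\<lambda>s. indicator {0..t} s *\<^sub>R f s"] show ?thesis
    using \<open>0 \<le> t\<close> unfolding zero_ereal_def interval_integral_Icc[OF \<open>0 \<le> t\<close>] set_lebesgue_integral_def
    by linarith
qed

text \<open>A bound \<open>L\<close> for both Wiener integrals gives \<open>L * \<gamma>\<^sub>1\<close> for the first coefficient. The recursion is
  homogeneous: each product \<open>x\<^sub>j * x\<^sub>n\<^sub>-\<^sub>j\<close> picks up \<open>L ^ j * L ^ (n - j) = L ^ n\<close>, and the bounds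
  \<^const>\<open>gamma_fun\<close> solve the same recursion with absolute values.\<close>
lemma x_proc_le_gamma_fun:
  assumes w: "continuous_on UNIV w1" "continuous_on UNIV w2"
    and I: "\<And>t. 0 \<le> t \<Longrightarrow> t \<le> T \<Longrightarrow> \<bar>I1 t \<omega>\<bar> \<le> L" "\<And>t. 0 \<le> t \<Longrightarrow> t \<le> T \<Longrightarrow> \<bar>I2 t \<omega>\<bar> \<le> L"
    and "0 \<le> L" "1 \<le> n" "0 \<le> t" "t \<le> T"
  shows "\<bar>x_proc x0 w1 w2 I1 I2 n t \<omega>\<bar> \<le> L ^ n * gamma_fun w1 w2 n t"
  using \<open>1 \<le> n\<close> \<open>0 \<le> t\<close> \<open>t \<le> T\<close>
proof (induction n arbitrary: t rule: less_induct)
  case (less n)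
  consider "n = Suc 0" | m where "n = Suc (Suc m)"
    using less.prems(1) by (metis not0_implies_Suc One_nat_def not_one_le_zero)
  then show ?case
  proof cases
    case 1
    have "\<bar>w2 t * I1 t \<omega> - w1 t * I2 t \<omega>\<bar> \<le> \<bar>w2 t\<bar> * \<bar>I1 t \<omega>\<bar> + \<bar>w1 t\<bar> * \<bar>I2 t \<omega>\<bar>"
      by (metis abs_mult abs_triangle_ineq4)
    also have "\<dots> \<le> \<bar>w2 t\<bar> * L + \<bar>w1 t\<bar> * L"
      using less.prems by (intro add_mono mult_left_mono I) auto
    finally show ?thesis by (simp add: 1 algebra_simps)
  next
    case 2
    let ?x = "\<lambda>j s. x_proc x0 w1 w2 I1 I2 j s \<omega>" and ?g = "gamma_fun w1 w2"
    let ?G = "\<lambda>s. \<Sum>j=1..Suc m. ?g j s * ?g (n - j) s"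
    have "\<bar>kernel_K w1 w2 t s * (\<Sum>j=1..Suc m. ?x j s * ?x (n - j) s)\<bar>
        \<le> L ^ n * (\<bar>kernel_K w1 w2 t s\<bar> * ?G s)" if s: "0 \<le> s" "s \<le> t" for s
    proof -
      have "\<bar>\<Sum>j=1..Suc m. ?x j s * ?x (n - j) s\<bar> \<le> (\<Sum>j=1..Suc m. \<bar>?x j s\<bar> * \<bar>?x (n - j) s\<bar>)"
        unfolding abs_mult[symmetric] by (rule sum_abs)
      also have "\<dots> \<le> (\<Sum>j=1..Suc m. (L ^ j * ?g j s) * (L ^ (n - j) * ?g (n - j) s))"
        using s less.prems \<open>0 \<le> L\<close>
        by (intro sum_mono mult_mono less.IH mult_nonneg_nonneg gamma_fun_nonneg) (auto simp: 2)
      also have "\<dots> = (\<Sum>j=1..Suc m. L ^ n * (?g j s * ?g (n - j) s))"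
      proof (intro sum.cong refl)
        fix j assume "j \<in> {1..Suc m}"
        then have "L ^ n = L ^ j * L ^ (n - j)" by (simp add: 2 flip: power_add)
        then show "(L ^ j * ?g j s) * (L ^ (n - j) * ?g (n - j) s) = L ^ n * (?g j s * ?g (n - j) s)"
          by simp
      qed
      finally have "\<bar>kernel_K w1 w2 t s\<bar> * \<bar>\<Sum>j=1..Suc m. ?x j s * ?x (n - j) s\<bar>
          \<le> \<bar>kernel_K w1 w2 t s\<bar> * (L ^ n * ?G s)"
        unfolding sum_distrib_left[symmetric] by (rule mult_left_mono) simp
      then show ?thesis unfolding abs_mult by (simp only: mult.left_commute)
    qed
    moreover have "continuous_on UNIV (\<lambda>s. L ^ n * (\<bar>kernel_K w1 w2 t s\<bar> * ?G s))"
      by (intro continuous_intros continuous_on_kernel[OF w] continuous_on_gamma_fun[OF w])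
    ultimately have "\<bar>LBINT s=0..t. kernel_K w1 w2 t s * (\<Sum>j=1..Suc m. ?x j s * ?x (n - j) s)\<bar>
        \<le> (LBINT s=0..t. L ^ n * (\<bar>kernel_K w1 w2 t s\<bar> * ?G s))"
      using less.prems by (intro abs_interval_integral_le) auto
    also have "\<dots> = L ^ n * (LBINT s=0..t. \<bar>kernel_K w1 w2 t s\<bar> * ?G s)"
      by (rule interval_lebesgue_integral_mult_right)
    finally show ?thesis unfolding 2 by simp
  qed
qed

text \<open>With \<open>L = 1 / \<sigma>\<close> the factors \<open>\<sigma> ^ i\<close> and \<open>L ^ i\<close> cancel.\<close>
lemma X_approx_le_Gamma_sum:
  assumes w: "continuous_on UNIV w1" "continuous_on UNIV w2"
    and I: "\<And>t. 0 \<le> t \<Longrightarrow> t \<le> T \<Longrightarrow> \<bar>I1 t \<omega>\<bar> \<le> 1 / \<sigma>" "\<And>t. 0 \<le> t \<Longrightarrow> t \<le> T \<Longrightarrow> \<bar>I2 t \<omega>\<bar> \<le> 1 / \<sigma>"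
    and "0 < \<sigma>" "0 \<le> t" "t \<le> T"
  shows "\<bar>X_approx x0 w1 w2 I1 I2 \<sigma> n t \<omega> - x0 t\<bar> \<le> Gamma_sum w1 w2 n t"
proof -
  let ?x = "\<lambda>i. x_proc x0 w1 w2 I1 I2 i t \<omega>"
  have "\<bar>X_approx x0 w1 w2 I1 I2 \<sigma> n t \<omega> - x0 t\<bar> = \<bar>\<Sum>i=1..n. \<sigma> ^ i * ?x i\<bar>"
    unfolding X_approx_def by (simp add: sum.atLeast_Suc_atMost)
  also have "\<dots> \<le> (\<Sum>i=1..n. \<sigma> ^ i * \<bar>?x i\<bar>)"
    using \<open>0 < \<sigma>\<close> by (intro order_trans[OF sum_abs]) (simp add: abs_mult)
  also have "\<dots> \<le> (\<Sum>i=1..n. \<sigma> ^ i * ((1 / \<sigma>) ^ i * gamma_fun w1 w2 i t))"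
    using assms by (intro sum_mono mult_left_mono x_proc_le_gamma_fun) auto
  also have "\<dots> = Gamma_sum w1 w2 n t"
    using \<open>0 < \<sigma>\<close> unfolding Gamma_sum_def by (simp add: power_one_over)
  finally show ?thesis .
qed

section \<open>The Ito isometry for step functions\<close>

lemma brownian_motion_borel_measurable:
  "brownian_motion M B \<Longrightarrow> 0 \<le> t \<Longrightarrow> B t \<in> borel_measurable M"
  by (simp add: brownian_motion_def)

lemma brownian_indep_increments:
  assumes "brownian_motion M B" "0 \<le> p 0" "\<And>i. i < N \<Longrightarrow> p i \<le> p (Suc i)"
  shows "prob_space.indep_vars M (\<lambda>_. borel) (\<lambda>i \<omega>. B (p (Suc i)) \<omega> - B (p i) \<omega>) {..<N}"
  using assms unfolding brownian_motion_def by blast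

lemma brownian_increment:
  assumes bm: "brownian_motion M B" and "0 \<le> s" "s \<le> t"
  shows "integrable M (\<lambda>\<omega>. B t \<omega> - B s \<omega>)"
    and "(\<integral>\<omega>. B t \<omega> - B s \<omega> \<partial>M) = 0"
    and "integrable M (\<lambda>\<omega>. (B t \<omega> - B s \<omega>)\<^sup>2)"
    and "(\<integral>\<omega>. (B t \<omega> - B s \<omega>)\<^sup>2 \<partial>M) = t - s"
proof -
  have "integrable M (\<lambda>\<omega>. B t \<omega> - B s \<omega>) \<and> (\<integral>\<omega>. B t \<omega> - B s \<omega> \<partial>M) = 0 \<and>
    integrable M (\<lambda>\<omega>. (B t \<omega> - B s \<omega>)\<^sup>2) \<and> (\<integral>\<omega>. (B t \<omega> - B s \<omega>)\<^sup>2 \<partial>M) = t - s"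
  proof (cases "s = t")
    case False
    with assms have "s < t" by simp
    then have D: "distributed M lborel (\<lambda>\<omega>. B t \<omega> - B s \<omega>) (normal_density 0 (sqrt (t - s)))"
      using bm \<open>0 \<le> s\<close> by (simp add: brownian_motion_def)
    have pos: "0 < sqrt (t - s)" using \<open>s < t\<close> by simp
    note m2 = normal_moment_even[OF pos, of 0 1]
    have m1: "integrable lborel (\<lambda>x. normal_density 0 (sqrt (t - s)) x * x)"
      "(\<integral>x. normal_density 0 (sqrt (t - s)) x * x \<partial>lborel) = 0"
      using integrable_normal_moment_nz_1[OF pos] integral_normal_moment_nz_1[OF pos, of 0] by auto
    have "integrable M (\<lambda>\<omega>. B t \<omega> - B s \<omega>)" "integrable M (\<lambda>\<omega>. (B t \<omega> - B s \<omega>)\<^sup>2)"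
      using distributed_integrable[OF D, of "\<lambda>x. x"] distributed_integrable[OF D, of "\<lambda>x. x\<^sup>2"]
        m1 integrable.intros[OF m2] by auto
    moreover have "(\<integral>\<omega>. B t \<omega> - B s \<omega> \<partial>M) = 0" "(\<integral>\<omega>. (B t \<omega> - B s \<omega>)\<^sup>2 \<partial>M) = t - s"
      using distributed_integral[OF D, of "\<lambda>x. x"] distributed_integral[OF D, of "\<lambda>x. x\<^sup>2"]
        m1 has_bochner_integral_integral_eq[OF m2] \<open>s < t\<close> by (auto simp: fact_numeral)
    ultimately show ?thesis by blast
  qed simp
  then show "integrable M (\<lambda>\<omega>. B t \<omega> - B s \<omega>)"
    and "(\<integral>\<omega>. B t \<omega> - B s \<omega> \<partial>M) = 0"
    and "integrable M (\<lambda>\<omega>. (B t \<omega> - B s \<omega>)\<^sup>2)"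
    and "(\<integral>\<omega>. (B t \<omega> - B s \<omega>)\<^sup>2 \<partial>M) = t - s"
    by blast+
qed

text \<open>Increments from time 0 are used instead of \<open>B\<close> itself: \<open>B 0\<close> vanishes only almost surely, and
  this way no null set has to be carried along.\<close>
lemma brownian_covariance:
  assumes bm: "brownian_motion M B" and "0 \<le> s" "0 \<le> t"
  shows "has_bochner_integral M (\<lambda>\<omega>. (B s \<omega> - B 0 \<omega>) * (B t \<omega> - B 0 \<omega>)) (min s t)"
proof -
  interpret prob_space M using bm by (simp add: brownian_motion_def)
  have main: "has_bochner_integral M (\<lambda>\<omega>. (B s \<omega> - B 0 \<omega>) * (B t \<omega> - B 0 \<omega>)) s"
    if "0 \<le> s" "s \<le> t" for s t
  proof -
    define p :: "nat \<Rightarrow> real" where "p i = (if i = 0 then 0 else if i = 1 then s else t)" for i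
    have "indep_vars (\<lambda>_. borel) (\<lambda>i \<omega>. B (p (Suc i)) \<omega> - B (p i) \<omega>) {..<2}"
      using that by (intro brownian_indep_increments[OF bm]) (auto simp: p_def)
    from indep_var_restrict[OF this, of "{0}" "{1}"]
    have "indep_var (PiM {0} (\<lambda>_. borel)) (\<lambda>\<omega>. \<lambda>i\<in>{0}. B (p (Suc i)) \<omega> - B (p i) \<omega>)
        (PiM {1} (\<lambda>_. borel)) (\<lambda>\<omega>. \<lambda>i\<in>{1}. B (p (Suc i)) \<omega> - B (p i) \<omega>)"
      by auto
    from indep_var_compose[OF this measurable_component_singleton[of 0]
        measurable_component_singleton[of 1]]
    have ind: "indep_var borel (\<lambda>\<omega>. B s \<omega> - B 0 \<omega>) borel (\<lambda>\<omega>. B t \<omega> - B s \<omega>)"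
      by (simp add: p_def comp_def)
    note inc = brownian_increment[OF bm]
    have "has_bochner_integral M
      (\<lambda>\<omega>. (B s \<omega> - B 0 \<omega>)\<^sup>2 + (B s \<omega> - B 0 \<omega>) * (B t \<omega> - B s \<omega>)) (s + 0)"
      using indep_var_integrable[OF ind] indep_var_lebesgue_integral[OF ind]
        inc[of 0 s] inc[of s t] that
      by (intro has_bochner_integral_add) (auto simp: has_bochner_integral_iff)
    then show ?thesis by (simp add: power2_eq_square algebra_simps)
  qed
  show ?thesis
    using main[of s t] main[of t s] assms by (cases "s \<le> t") (auto simp: mult.commute)
qed

text \<open>The value is the length of the overlap of \<open>{a<..b}\<close> and \<open>{c<..d}\<close>, that is, the inner product of
  the two indicators in \<open>L\<^sup>2\<close>.\<close>
lemma brownian_increment_product: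
  assumes bm: "brownian_motion M B" and "0 \<le> a" "a \<le> b" "0 \<le> c" "c \<le> d"
  shows "has_bochner_integral M (\<lambda>\<omega>. (B b \<omega> - B a \<omega>) * (B d \<omega> - B c \<omega>)) (max 0 (min b d - max a c))"
proof -
  note cov = brownian_covariance[OF bm]
  have "has_bochner_integral M (\<lambda>\<omega>. (B b \<omega> - B 0 \<omega>) * (B d \<omega> - B 0 \<omega>) - (B b \<omega> - B 0 \<omega>) * (B c \<omega> - B 0 \<omega>)
      - ((B a \<omega> - B 0 \<omega>) * (B d \<omega> - B 0 \<omega>) - (B a \<omega> - B 0 \<omega>) * (B c \<omega> - B 0 \<omega>)))
     (min b d - min b c - (min a d - min a c))"
    using assms by (intro has_bochner_integral_diff cov) auto
  moreover have "min b d - min b c - (min a d - min a c) = max 0 (min b d - max a c)"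
    using assms by (auto simp: min_def max_def)
  ultimately show ?thesis by (simp add: algebra_simps)
qed

lemma emeasure_lborel_Ioc_finite: "emeasure lborel {a<..b::real} < \<top>"
  by (cases "a \<le> b") simp_all

lemma indicator_Ioc_product:
  fixes a b c d :: real
  assumes "a \<le> b" "c \<le> d"
  shows "has_bochner_integral lborel (\<lambda>s. indicator {a<..b} s * indicator {c<..d} s :: real)
    (max 0 (min b d - max a c))"
proof -
  have "(\<lambda>s. indicator {a<..b} s * indicator {c<..d} s :: real) = indicator {max a c<..min b d}"
    by (auto simp: fun_eq_iff split: split_indicator)
  moreover have "has_bochner_integral lborel (indicator {max a c<..min b d} :: real \<Rightarrow> real)
      (measure lborel {max a c<..min b d})"
    by (rule has_bochner_integral_real_indicator) (simp_all add: emeasure_lborel_Ioc_finite)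
  moreover have "measure lborel {max a c<..min b d} = max 0 (min b d - max a c)"
    by (cases "max a c \<le> min b d") auto
  ultimately show ?thesis by simp
qed

text \<open>Both sides expand into the same double sum of overlap lengths. Since the intervals may overlap
  arbitrarily, two step functions on different partitions can be compared without passing to a
  common refinement.\<close>
lemma brownian_combination_isometry:
  fixes c a b :: "'i \<Rightarrow> real"
  assumes bm: "brownian_motion M B" and "finite I"
    and ab: "\<And>i. i \<in> I \<Longrightarrow> 0 \<le> a i" "\<And>i. i \<in> I \<Longrightarrow> a i \<le> b i"
  shows "(\<integral>\<^sup>+ \<omega>. ennreal ((\<Sum>i\<in>I. c i * (B (b i) \<omega> - B (a i) \<omega>))\<^sup>2) \<partial>M)
    = (\<integral>\<^sup>+ s. ennreal ((\<Sum>i\<in>I. c i * indicator {a i<..b i} s)\<^sup>2) \<partial>lborel)"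
proof -
  let ?r = "\<Sum>i\<in>I. \<Sum>j\<in>I. c i * c j * max 0 (min (b i) (b j) - max (a i) (a j))"
  have "has_bochner_integral M (\<lambda>\<omega>. \<Sum>i\<in>I. \<Sum>j\<in>I. c i * c j * ((B (b i) \<omega> - B (a i) \<omega>) * (B (b j) \<omega> - B (a j) \<omega>))) ?r"
    using ab by (intro has_bochner_integral_sum has_bochner_integral_mult_right
        brownian_increment_product[OF bm]) auto
  then have 1: "has_bochner_integral M (\<lambda>\<omega>. (\<Sum>i\<in>I. c i * (B (b i) \<omega> - B (a i) \<omega>))\<^sup>2) ?r"
    unfolding power2_eq_square sum_product by (simp add: mult_ac)
  have "has_bochner_integral lborel (\<lambda>s. \<Sum>i\<in>I. \<Sum>j\<in>I. c i * c j * (indicator {a i<..b i} s * indicator {a j<..b j} s)) ?r"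
    using ab by (intro has_bochner_integral_sum has_bochner_integral_mult_right
        indicator_Ioc_product) auto
  then have 2: "has_bochner_integral lborel (\<lambda>s. (\<Sum>i\<in>I. c i * indicator {a i<..b i} s)\<^sup>2) ?r"
    unfolding power2_eq_square sum_product by (simp add: mult_ac)
  from 1 2 show ?thesis
    by (simp add: has_bochner_integral_iff nn_integral_eq_integral)
qed

lemma is_partition_nonneg:
  assumes "is_partition t N p" "i \<le> N"
  shows "0 \<le> p i"
  using assms(2)
proof (induction i)
  case (Suc i)
  with assms(1) have "p i \<le> p (Suc i)" by (simp add: is_partition_def)
  with Suc show ?case by simp
qed (use assms(1) in \<open>simp add: is_partition_def\<close>)

lemma is_partition_le:
  assumes "is_partition t N p" "i \<le> N"
  shows "p i \<le> t"
  using assms(2)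
proof (induction i rule: inc_induct)
  case (step i)
  with assms(1) have "p i \<le> p (Suc i)" by (simp add: is_partition_def)
  with step show ?case by simp
qed (use assms(1) in \<open>simp add: is_partition_def\<close>)

text \<open>A difference of two step functions is a combination of interval indicators over the disjoint sum of
  the two index sets.\<close>
lemma step_integral_isometry:
  assumes bm: "brownian_motion M B" and p: "is_partition t N p" and p': "is_partition t N' p'"
  shows "(\<integral>\<^sup>+ \<omega>. ennreal ((step_integral B N p v \<omega> - step_integral B N' p' v' \<omega>)\<^sup>2) \<partial>M)
    = (\<integral>\<^sup>+ s\<in>{0..t}. ennreal ((step_fun N p v s - step_fun N' p' v' s)\<^sup>2) \<partial>lborel)"
proof -
  let ?I = "{..<N} <+> {..<N'}"
  define c where "c = case_sum v (\<lambda>i. - v' i)"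
  define a where "a = case_sum p p'"
  define b where "b = case_sum (\<lambda>i. p (Suc i)) (\<lambda>i. p' (Suc i))"
  have ab: "0 \<le> a i" "a i \<le> b i" "b i \<le> t" if "i \<in> ?I" for i
    using that p p' is_partition_nonneg[OF p] is_partition_nonneg[OF p']
      is_partition_le[OF p] is_partition_le[OF p']
    by (auto simp: a_def b_def is_partition_def)
  have eq: "step_fun N p v s - step_fun N' p' v' s = (\<Sum>i\<in>?I. c i * indicator {a i<..b i} s)" for s
    unfolding step_fun_def a_def b_def c_def sum.Plus[OF finite_lessThan finite_lessThan] sum.case comp_def
    by (simp only: mult_minus_left sum_negf diff_conv_add_uminus)
  have 0: "(\<Sum>i\<in>?I. c i * indicator {a i<..b i} s) = 0" if "s \<notin> {0..t}" for s
  proof (intro sum.neutral ballI)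
    fix i assume "i \<in> ?I"
    with ab[OF this] that have "s \<notin> {a i<..b i}" by auto
    then show "c i * indicator {a i<..b i} s = 0" by simp
  qed
  have "step_integral B N p v \<omega> - step_integral B N' p' v' \<omega> = (\<Sum>i\<in>?I. c i * (B (b i) \<omega> - B (a i) \<omega>))" for \<omega>
    by (simp add: sum.Plus step_integral_def a_def b_def c_def sum_negf)
  then have "(\<integral>\<^sup>+ \<omega>. ennreal ((step_integral B N p v \<omega> - step_integral B N' p' v' \<omega>)\<^sup>2) \<partial>M)
    = (\<integral>\<^sup>+ s. ennreal ((\<Sum>i\<in>?I. c i * indicator {a i<..b i} s)\<^sup>2) \<partial>lborel)"
    using brownian_combination_isometry[OF bm, of ?I a b c] ab by simp
  also have "\<dots> = (\<integral>\<^sup>+ s\<in>{0..t}. ennreal ((step_fun N p v s - step_fun N' p' v' s)\<^sup>2) \<partial>lborel)"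
  proof (rule nn_integral_cong)
    fix s
    show "ennreal ((\<Sum>i\<in>?I. c i * indicator {a i<..b i} s)\<^sup>2)
      = ennreal ((step_fun N p v s - step_fun N' p' v' s)\<^sup>2) * indicator {0..t} s"
      unfolding eq
      by (cases "s \<in> {0..t}") (simp_all only: 0 simp_thms not_False_eq_True indicator_simps mult_1_right power_zero_numeral ennreal_0 mult_zero_left)
  qed
  finally show ?thesis .
qed

lemma nn_integral_square_triangle:
  fixes f g h :: "'b \<Rightarrow> real"
  assumes [measurable]: "f \<in> borel_measurable N" "g \<in> borel_measurable N" "h \<in> borel_measurable N"
  shows "(\<integral>\<^sup>+ x. ennreal ((f x - h x)\<^sup>2) \<partial>N)
    \<le> 2 * (\<integral>\<^sup>+ x. ennreal ((f x - g x)\<^sup>2) \<partial>N) + 2 * (\<integral>\<^sup>+ x. ennreal ((g x - h x)\<^sup>2) \<partial>N)"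
proof -
  have "(u - w)\<^sup>2 \<le> 2 * (u - v)\<^sup>2 + 2 * (v - w)\<^sup>2" for u v w :: real
    using zero_le_power2[of "u - 2 * v + w"] by (simp add: power2_eq_square algebra_simps)
  then have "(\<integral>\<^sup>+ x. ennreal ((f x - h x)\<^sup>2) \<partial>N)
      \<le> (\<integral>\<^sup>+ x. ennreal (2 * (f x - g x)\<^sup>2 + 2 * (g x - h x)\<^sup>2) \<partial>N)"
    by (intro nn_integral_mono ennreal_leI)
  also have "\<dots> = (\<integral>\<^sup>+ x. 2 * ennreal ((f x - g x)\<^sup>2) + 2 * ennreal ((g x - h x)\<^sup>2) \<partial>N)"
    by (intro nn_integral_cong) (simp add: ennreal_plus ennreal_mult del: ennreal_plus[symmetric])
  finally show ?thesis by (simp add: nn_integral_add nn_integral_cmult)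
qed

lemma step_fun_measurable [measurable]: "step_fun N p v \<in> borel_measurable borel"
  unfolding step_fun_def[abs_def] by measurable

lemma step_integral_measurable:
  assumes bm: "brownian_motion M B" and p: "is_partition t N p"
  shows "step_integral B N p v \<in> borel_measurable M"
  unfolding step_integral_def[abs_def]
  using is_partition_nonneg[OF p]
  by (intro borel_measurable_sum borel_measurable_times borel_measurable_diff
      brownian_motion_borel_measurable[OF bm] borel_measurable_const) auto

text \<open>The step functions that define \<open>J\<close> are unknown, but by the isometry the distance of their integrals
  to the integral of any other step function is controlled by the distance of the integrands. So a
  convenient approximation can be chosen freely. The constant 4 comes from using
  \<open>(x + y)\<^sup>2 \<le> 2 * x\<^sup>2 + 2 * y\<^sup>2\<close> twice.\<close>
lemma stoch_integral_step_distance: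
  assumes bm: "brownian_motion M B" and J: "is_stoch_integral M B f t J"
    and f [measurable]: "f \<in> borel_measurable borel" and p: "is_partition t N p"
  shows "(\<integral>\<^sup>+ \<omega>. ennreal ((J \<omega> - step_integral B N p v \<omega>)\<^sup>2) \<partial>M)
    \<le> 4 * (\<integral>\<^sup>+ s\<in>{0..t}. ennreal ((f s - step_fun N p v s)\<^sup>2) \<partial>lborel)"
proof -
  from J obtain N' p' v' where
    p': "\<And>k. is_partition t (N' k) (p' k)" and
    f': "(\<lambda>k. \<integral>\<^sup>+ s\<in>{0..t}. ennreal ((f s - step_fun (N' k) (p' k) (v' k) s)\<^sup>2) \<partial>lborel) \<longlonglongrightarrow> 0" and
    J': "(\<lambda>k. \<integral>\<^sup>+ \<omega>. ennreal ((J \<omega> - step_integral B (N' k) (p' k) (v' k) \<omega>)\<^sup>2) \<partial>M) \<longlonglongrightarrow> 0" and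
    [measurable]: "J \<in> borel_measurable M"
    unfolding is_stoch_integral_def by blast
  note [measurable] = step_integral_measurable[OF bm p] step_integral_measurable[OF bm p']
  let ?L = "restrict_space lborel {0..t}"
  have restr: "(\<integral>\<^sup>+ s\<in>{0..t}. h s \<partial>lborel) = (\<integral>\<^sup>+ s. h s \<partial>?L)" for h
    by (simp add: nn_integral_restrict_space)
  define e where "e k = (\<integral>\<^sup>+ \<omega>. ennreal ((J \<omega> - step_integral B (N' k) (p' k) (v' k) \<omega>)\<^sup>2) \<partial>M)" for k
  define d where "d k = (\<integral>\<^sup>+ s. ennreal ((f s - step_fun (N' k) (p' k) (v' k) s)\<^sup>2) \<partial>?L)" for k
  define D where "D = (\<integral>\<^sup>+ s. ennreal ((f s - step_fun N p v s)\<^sup>2) \<partial>?L)"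
  have bound: "(\<integral>\<^sup>+ \<omega>. ennreal ((J \<omega> - step_integral B N p v \<omega>)\<^sup>2) \<partial>M) \<le> 2 * e k + 2 * (2 * d k + 2 * D)" for k
  proof -
    have "(\<integral>\<^sup>+ \<omega>. ennreal ((step_integral B (N' k) (p' k) (v' k) \<omega> - step_integral B N p v \<omega>)\<^sup>2) \<partial>M)
      = (\<integral>\<^sup>+ s. ennreal ((step_fun (N' k) (p' k) (v' k) s - step_fun N p v s)\<^sup>2) \<partial>?L)"
      unfolding restr[symmetric] by (rule step_integral_isometry[OF bm p' p])
    also have "\<dots> \<le> 2 * (\<integral>\<^sup>+ s. ennreal ((step_fun (N' k) (p' k) (v' k) s - f s)\<^sup>2) \<partial>?L) + 2 * D"
      unfolding D_def by (rule nn_integral_square_triangle) (auto intro: measurable_restrict_space1)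
    also have "\<dots> = 2 * d k + 2 * D"
      unfolding d_def by (simp add: power2_commute)
    finally show ?thesis
      unfolding e_def
      by (intro order_trans[OF nn_integral_square_triangle[of J M "step_integral B (N' k) (p' k) (v' k)"]]
          add_left_mono mult_left_mono) auto
  qed
  have "(\<lambda>k. 2 * e k + 2 * (2 * d k + 2 * D)) \<longlonglongrightarrow> 2 * 0 + 2 * (2 * 0 + 2 * D)"
    using f' J' unfolding restr by (intro tendsto_intros) (auto simp: e_def[abs_def] d_def[abs_def])
  then have "(\<integral>\<^sup>+ \<omega>. ennreal ((J \<omega> - step_integral B N p v \<omega>)\<^sup>2) \<partial>M) \<le> 2 * 0 + 2 * (2 * 0 + 2 * D)"
    by (rule LIMSEQ_le_const) (use bound in blast)
  then show ?thesis by (simp add: D_def restr mult.assoc[symmetric])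
qed

section \<open>Maximal inequality and first moments for sums of independent variables\<close>

text \<open>Doob's weak type inequality for the partial sums \<open>S\<^sub>j\<close>. Let \<open>A\<^sub>j\<close> be the event that the level \<open>\<mu>\<close> has been
  exceeded up to time \<open>j\<close>. By induction \<open>\<mu> * P(A\<^sub>j) \<le> E(|S\<^sub>j|; A\<^sub>j)\<close>: on \<open>A\<^sub>j\<close> the right hand side does
  not decrease in the next step, because \<open>|S\<^sub>j + X\<^sub>j| \<ge> |S\<^sub>j| + sgn S\<^sub>j * X\<^sub>j\<close> and \<open>X\<^sub>j\<close> is centred and
  independent of \<open>sgn S\<^sub>j\<close> on \<open>A\<^sub>j\<close>; on the newly added part of \<open>A\<^sub>j\<^sub>+\<^sub>1\<close> the sum exceeds \<open>\<mu>\<close>.\<close>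
lemma (in prob_space) indep_sums_maximal_inequality:
  fixes X :: "nat \<Rightarrow> 'a \<Rightarrow> real" and \<mu> :: real
  assumes X: "indep_vars (\<lambda>_. borel) X {..<N}"
    and int: "\<And>i. i < N \<Longrightarrow> integrable M (X i)" and mean: "\<And>i. i < N \<Longrightarrow> expectation (X i) = 0"
    and "0 \<le> \<mu>"
  shows "\<mu> * prob {\<omega> \<in> space M. \<exists>j\<in>{..N}. \<mu> < \<bar>\<Sum>i<j. X i \<omega>\<bar>} \<le> expectation (\<lambda>\<omega>. \<bar>\<Sum>i<N. X i \<omega>\<bar>)"
proof -
  define S where "S j \<omega> = (\<Sum>i<j. X i \<omega>)" for j \<omega>
  define A where "A j = {\<omega> \<in> space M. \<exists>i\<in>{..j}. \<mu> < \<bar>S i \<omega>\<bar>}" for j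
  have S_int: "integrable M (S j)" if "j \<le> N" for j
    unfolding S_def[abs_def] using that int by auto
  have A: "A j \<in> events" if "j \<le> N" for j
  proof -
    have "S i \<in> borel_measurable M" if "i \<in> {..j}" for i
      using that \<open>j \<le> N\<close> S_int by auto
    then show ?thesis unfolding A_def by measurable
  qed
  have prod_int: "integrable M (\<lambda>\<omega>. h \<omega> * Y \<omega>)"
    if "integrable M Y" "h \<in> borel_measurable M" "\<And>\<omega>. \<bar>h \<omega>\<bar> \<le> 1" for h Y :: "'a \<Rightarrow> real"
    using that by (intro Bochner_Integration.integrable_bound[OF that(1)]) (auto simp: abs_mult intro!: mult_left_le_one_le)
  have bnd: "\<bar>sgn x * indicator B \<omega>\<bar> \<le> 1" for x :: real and B :: "'a set" and \<omega>
    by (auto simp: abs_sgn_eq split: split_indicator)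
  have "\<mu> * prob (A j) \<le> expectation (\<lambda>\<omega>. \<bar>S j \<omega>\<bar> * indicator (A j) \<omega>)" if "j \<le> N" for j
    using that
  proof (induction j)
    case 0
    have "A 0 = {}" using \<open>0 \<le> \<mu>\<close> by (simp add: A_def S_def)
    then show ?case by simp
  next
    case (Suc j)
    then have j: "j < N" "j \<le> N" "Suc j \<le> N" by auto
    note [measurable] = A[OF j(2)] A[OF j(3)]
    have [measurable]: "S j \<in> borel_measurable M" "S (Suc j) \<in> borel_measurable M" "X j \<in> borel_measurable M"
      using S_int j int by auto
    let ?P = "PiM {..<j} (\<lambda>_. borel :: real measure)"
    let ?h = "\<lambda>\<omega>. sgn (S j \<omega>) * indicator (A j) \<omega>"
    \<comment> \<open>\<open>?h\<close> as a function of the first \<open>j\<close> variables, so that independence from \<open>X j\<close> applies.\<close>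
    define g where "g x = sgn (\<Sum>i<j. x i) * (if \<exists>i\<in>{..j}. \<mu> < \<bar>\<Sum>l<i. x l\<bar> then 1 else 0)" for x :: "nat \<Rightarrow> real"
    have "(\<lambda>x. \<Sum>l<i. x l) \<in> borel_measurable ?P" if "i \<in> {..j}" for i
      using that by (intro borel_measurable_sum measurable_component_singleton) auto
    moreover have "(\<lambda>x. \<Sum>l<j. x l) \<in> borel_measurable ?P"
      by (intro borel_measurable_sum measurable_component_singleton) auto
    ultimately have g: "g \<in> borel_measurable ?P"
      unfolding g_def[abs_def] by measurable
    have "indep_var ?P (\<lambda>\<omega>. \<lambda>i\<in>{..<j}. X i \<omega>) (PiM {j} (\<lambda>_. borel)) (\<lambda>\<omega>. \<lambda>i\<in>{j}. X i \<omega>)"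
      using j by (intro indep_var_restrict[OF X]) auto
    from indep_var_compose[OF this g measurable_component_singleton[of j]]
    have ind: "indep_var borel (\<lambda>\<omega>. g (\<lambda>i\<in>{..<j}. X i \<omega>)) borel (X j)"
      by (simp add: comp_def)
    have g_h: "g (\<lambda>i\<in>{..<j}. X i \<omega>) = ?h \<omega>" if "\<omega> \<in> space M" for \<omega>
    proof -
      have "(\<Sum>l<i. (\<lambda>i\<in>{..<j}. X i \<omega>) l) = S i \<omega>" if "i \<le> j" for i
        unfolding S_def using that by (intro sum.cong) auto
      then show ?thesis using that by (auto simp: g_def A_def indicator_def)
    qed
    have g_int: "integrable M (\<lambda>\<omega>. g (\<lambda>i\<in>{..<j}. X i \<omega>))"
      using integrable_const[of "1::real"] bnd
      by (subst Bochner_Integration.integrable_cong[OF refl g_h]) (auto intro: prod_int[of "\<lambda>_. 1" ?h, simplified])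
    have "expectation (\<lambda>\<omega>. ?h \<omega> * X j \<omega>) = expectation (\<lambda>\<omega>. g (\<lambda>i\<in>{..<j}. X i \<omega>) * X j \<omega>)"
      by (intro Bochner_Integration.integral_cong) (auto simp: g_h)
    also have "\<dots> = 0"
      using indep_var_lebesgue_integral[OF ind g_int int[OF j(1)]] mean[OF j(1)] by simp
    finally have zero: "expectation (\<lambda>\<omega>. ?h \<omega> * X j \<omega>) = 0" .
    have "\<mu> * prob (A (Suc j)) = \<mu> * prob (A j) + \<mu> * (prob (A (Suc j)) - prob (A j))"
      by (simp add: algebra_simps)
    also have "\<dots> \<le> expectation (\<lambda>\<omega>. \<bar>S j \<omega>\<bar> * indicator (A j) \<omega>) + expectation (\<lambda>\<omega>. ?h \<omega> * X j \<omega>)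
        + \<mu> * (prob (A (Suc j)) - prob (A j))"
      using Suc by (simp add: zero)
    also have "\<dots> = expectation (\<lambda>\<omega>. \<bar>S j \<omega>\<bar> * indicator (A j) \<omega> + ?h \<omega> * X j \<omega>
        + \<mu> * (indicator (A (Suc j)) \<omega> - indicator (A j) \<omega>))"
    proof -
      have "integrable M (\<lambda>\<omega>. \<bar>S j \<omega>\<bar> * indicator (A j) \<omega>)"
        using S_int[OF j(2)] by (intro integrable_real_mult_indicator) auto
      moreover have "integrable M (\<lambda>\<omega>. ?h \<omega> * X j \<omega>)"
        using int[OF j(1)] bnd by (intro prod_int) auto
      ultimately show ?thesis
        by (simp add: less_top[symmetric])
    qed
    also have "\<dots> \<le> expectation (\<lambda>\<omega>. \<bar>S (Suc j) \<omega>\<bar> * indicator (A (Suc j)) \<omega>)"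
    proof (rule integral_mono)
      show "integrable M (\<lambda>\<omega>. \<bar>S j \<omega>\<bar> * indicator (A j) \<omega> + ?h \<omega> * X j \<omega>
        + \<mu> * (indicator (A (Suc j)) \<omega> - indicator (A j) \<omega>))"
        using S_int[OF j(2)] int[OF j(1)] bnd
        by (intro Bochner_Integration.integrable_add prod_int integrable_real_mult_indicator
            integrable_mult_right Bochner_Integration.integrable_diff) (auto simp: less_top[symmetric])
      show "integrable M (\<lambda>\<omega>. \<bar>S (Suc j) \<omega>\<bar> * indicator (A (Suc j)) \<omega>)"
        using S_int[OF j(3)] by (intro integrable_real_mult_indicator) auto
      fix \<omega> assume "\<omega> \<in> space M"
      show "\<bar>S j \<omega>\<bar> * indicator (A j) \<omega> + ?h \<omega> * X j \<omega>
        + \<mu> * (indicator (A (Suc j)) \<omega> - indicator (A j) \<omega>) \<le> \<bar>S (Suc j) \<omega>\<bar> * indicator (A (Suc j)) \<omega>"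
      proof (cases "\<omega> \<in> A j")
        case True
        moreover from True have "\<omega> \<in> A (Suc j)" by (auto simp: A_def)
        moreover have "\<bar>S j \<omega>\<bar> + sgn (S j \<omega>) * X j \<omega> \<le> \<bar>S (Suc j) \<omega>\<bar>"
          by (cases "S j \<omega>" "0::real" rule: linorder_cases) (auto simp: S_def)
        ultimately show ?thesis by simp
      next
        case False
        then have "\<mu> < \<bar>S (Suc j) \<omega>\<bar>" if "\<omega> \<in> A (Suc j)"
          using that by (auto simp: A_def le_Suc_eq)
        with False show ?thesis by (auto split: split_indicator)
      qed
    qed
    finally show ?case .
  qed
  from this[of N] have "\<mu> * prob (A N) \<le> expectation (\<lambda>\<omega>. \<bar>S N \<omega>\<bar> * indicator (A N) \<omega>)" by simp
  also have "\<dots> \<le> expectation (\<lambda>\<omega>. \<bar>S N \<omega>\<bar>)"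
    using S_int[of N] A[of N]
    by (intro integral_mono integrable_real_mult_indicator) (auto split: split_indicator)
  finally show ?thesis by (simp add: A_def S_def)
qed

text \<open>The step integral is a centred Gaussian variable, and \<open>E |N(0, s\<^sup>2)| = s * sqrt (2 / pi)\<close>.\<close>
lemma expectation_abs_step_integral:
  assumes bm: "brownian_motion M B" and p0: "0 \<le> p 0" and p: "\<And>i. i < N \<Longrightarrow> p i < p (Suc i)"
  shows "(\<integral>\<omega>. \<bar>step_integral B N p v \<omega>\<bar> \<partial>M)
    = sqrt (2 / pi) * sqrt (\<Sum>i<N. (v i)\<^sup>2 * (p (Suc i) - p i))"
proof -
  interpret prob_space M using bm by (simp add: brownian_motion_def)
  \<comment> \<open>Summands with \<open>v i = 0\<close> have no density and have to be left out.\<close>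
  define I where "I = {i. i < N \<and> v i \<noteq> 0}"
  have fin: "finite I" and sub: "I \<subseteq> {..<N}" by (auto simp: I_def)
  have sum_I: "(\<Sum>i<N. f i) = (\<Sum>i\<in>I. f i)" if "\<And>i. v i = 0 \<Longrightarrow> f i = 0" for f :: "nat \<Rightarrow> real"
    using that by (intro sum.mono_neutral_right) (auto simp: I_def)
  have p_nonneg: "0 \<le> p i" if "i \<le> N" for i
    using that
  proof (induction i)
    case (Suc i) then show ?case using p[of i] by simp
  qed (rule p0)
  let ?X = "\<lambda>i \<omega>. v i * (B (p (Suc i)) \<omega> - B (p i) \<omega>)"
  let ?\<sigma> = "\<lambda>i. \<bar>v i\<bar> * sqrt (p (Suc i) - p i)"
  show ?thesis
  proof (cases "I = {}")
    case True
    then show ?thesis unfolding step_integral_def by (subst (1 2) sum_I) auto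
  next
    case False
    have "indep_vars (\<lambda>_. borel) (\<lambda>i \<omega>. B (p (Suc i)) \<omega> - B (p i) \<omega>) {..<N}"
      using p by (intro brownian_indep_increments[where p = p, OF bm p0]) (auto intro: less_imp_le)
    then have ind: "indep_vars (\<lambda>_. borel) ?X I"
      by (intro indep_vars_subset[OF _ sub] indep_vars_compose2[where Y = "\<lambda>i x. v i * x"]) auto
    have "distributed M lborel (?X i) (normal_density 0 (?\<sigma> i))" if "i \<in> I" for i
    proof -
      have "distributed M lborel (\<lambda>\<omega>. B (p (Suc i)) \<omega> - B (p i) \<omega>) (normal_density 0 (sqrt (p (Suc i) - p i)))"
        using bm p p_nonneg that by (auto simp: brownian_motion_def I_def)
      from normal_density_affine[OF this, of "v i" 0] show ?thesis
        using p that by (auto simp: I_def)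
    qed
    then have D: "distributed M lborel (\<lambda>\<omega>. \<Sum>i\<in>I. ?X i \<omega>)
        (normal_density (\<Sum>i\<in>I. 0) (sqrt (\<Sum>i\<in>I. (?\<sigma> i)\<^sup>2)))"
      using p by (intro sum_indep_normal[OF fin False ind]) (auto simp: I_def)
    have "(\<Sum>i\<in>I. (?\<sigma> i)\<^sup>2) = (\<Sum>i\<in>I. (v i)\<^sup>2 * (p (Suc i) - p i))"
      using p by (intro sum.cong) (auto simp: power_mult_distrib I_def less_imp_le)
    also have "\<dots> = (\<Sum>i<N. (v i)\<^sup>2 * (p (Suc i) - p i))"
      by (rule sum_I[symmetric]) simp
    finally have var: "(\<Sum>i\<in>I. (?\<sigma> i)\<^sup>2) = (\<Sum>i<N. (v i)\<^sup>2 * (p (Suc i) - p i))" .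
    have "0 < (\<Sum>i\<in>I. (?\<sigma> i)\<^sup>2)"
    proof (intro sum_pos fin False)
      fix i assume "i \<in> I"
      with p[of i] show "0 < (?\<sigma> i)\<^sup>2" by (simp add: I_def)
    qed
    then have pos: "0 < sqrt (\<Sum>i<N. (v i)\<^sup>2 * (p (Suc i) - p i))" by (simp add: var)
    have "step_integral B N p v = (\<lambda>\<omega>. \<Sum>i\<in>I. ?X i \<omega>)"
      unfolding step_integral_def[abs_def] by (intro ext sum_I) simp
    with D have "distributed M lborel (step_integral B N p v)
        (normal_density 0 (sqrt (\<Sum>i<N. (v i)\<^sup>2 * (p (Suc i) - p i))))"
      unfolding var by simp
    from distributed_integral[OF this, of abs] integral_normal_moment_abs_odd[OF pos, of 0 0]
    show ?thesis by simp
  qed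
qed

section \<open>Step functions close to a continuous integrand\<close>

lemma step_fun_beyond:
  assumes "\<And>i. i < N \<Longrightarrow> p i \<le> p (Suc i)" "p N < s"
  shows "step_fun N p v s = 0"
proof -
  have "p (Suc i) \<le> p N" if "i < N" for i
    using that lift_Suc_mono_le[of "\<lambda>i. p (min i N)" "Suc i" N] assms(1)
    by (auto simp: min_def le_Suc_eq not_le less_Suc_eq)
  then show ?thesis
    using assms(2) unfolding step_fun_def by (intro sum.neutral) (fastforce simp: indicator_def)
qed

text \<open>The point \<open>s = p 0\<close> lies in no half-open cell, so the step function is 0 there.\<close>
lemma step_fun_approximates:
  assumes "\<And>i. i < N \<Longrightarrow> p i \<le> p (Suc i)"
    and "\<And>i s. i < N \<Longrightarrow> p i \<le> s \<Longrightarrow> s \<le> p (Suc i) \<Longrightarrow> \<bar>f s - v i\<bar> \<le> e"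
    and "p 0 < s" "s \<le> p N"
  shows "\<bar>f s - step_fun N p v s\<bar> \<le> e"
  using assms
proof (induction N)
  case (Suc N)
  have split: "step_fun (Suc N) p v s = step_fun N p v s + v N * indicator {p N<..p (Suc N)} s"
    unfolding step_fun_def by simp
  show ?case
  proof (cases "s \<le> p N")
    case True
    then show ?thesis using Suc unfolding split by auto
  next
    case False
    then have "step_fun N p v s = 0" using Suc.prems(1) by (intro step_fun_beyond) auto
    then show ?thesis using False Suc.prems(2)[of N s] Suc.prems(4) unfolding split by simp
  qed
qed simp

text \<open>Values dominated by \<open>|f|\<close> on the whole cell make the variance of the step integral at most the
  integral of \<open>f\<^sup>2\<close>, so that no limit of variances has to be taken.\<close>
lemma weighted_square_sum_le_integral:
  fixes f :: "real \<Rightarrow> real"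
  assumes f: "continuous_on UNIV f" and p0: "p 0 = 0" and p: "\<And>i. i < N \<Longrightarrow> p i \<le> p (Suc i)"
    and v: "\<And>i s. i < N \<Longrightarrow> p i \<le> s \<Longrightarrow> s \<le> p (Suc i) \<Longrightarrow> \<bar>v i\<bar> \<le> \<bar>f s\<bar>"
  shows "(\<Sum>i<N. (v i)\<^sup>2 * (p (Suc i) - p i)) \<le> (LBINT s=0..p N. (f s)\<^sup>2)"
  using p v
proof (induction N)
  case 0
  then show ?case by (simp add: p0 zero_ereal_def)
next
  case (Suc N)
  have f2: "continuous_on UNIV (\<lambda>s. (f s)\<^sup>2)" by (intro continuous_intros f)
  have "(v N)\<^sup>2 * (p (Suc N) - p N) = (LBINT s:{p N..p (Suc N)}. (v N)\<^sup>2)"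
    using Suc.prems(1)[of N] by (simp add: set_lebesgue_integral_def)
  also have "\<dots> \<le> (LBINT s:{p N..p (Suc N)}. (f s)\<^sup>2)"
    using Suc.prems(2)[of N]
    by (intro set_integral_mono borel_integrable_atLeastAtMost' continuous_on_const
        continuous_on_subset[OF f2]) (auto simp: abs_le_square_iff[symmetric])
  also have "\<dots> = (LBINT s=p N..p (Suc N). (f s)\<^sup>2)"
    using Suc.prems(1)[of N] by (simp add: interval_integral_Icc)
  also have "\<dots> = (LBINT s=0..p (Suc N). (f s)\<^sup>2) - (LBINT s=0..p N. (f s)\<^sup>2)"
    by (rule interval_integral_diff_endpoint[OF f2, symmetric])
  finally show ?case using Suc by simp
qed

section \<open>Measurability of the event\<close>

text \<open>Processes for which integrals over time and statements about all times are measurable. The paths are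
  required to be continuous on the whole line, which avoids boundary cases at time 0.\<close>
definition random_path :: "'a measure \<Rightarrow> (real \<Rightarrow> 'a \<Rightarrow> real) \<Rightarrow> bool" where
  "random_path M X \<longleftrightarrow> (\<forall>\<omega>\<in>space M. continuous_on UNIV (\<lambda>t. X t \<omega>)) \<and> (\<forall>t. X t \<in> borel_measurable M)"

text \<open>The process is the limit of its values at the times \<open>\<lfloor>t * k\<rfloor> / k\<close>, and these only depend on countably
  many random variables.\<close>
lemma random_path_joint_measurable:
  assumes "random_path M X"
  shows "(\<lambda>(\<omega>, t). X t \<omega>) \<in> borel_measurable (M \<Otimes>\<^sub>M lborel)"
proof (rule borel_measurable_LIMSEQ_real)
  let ?d = "\<lambda>k t. real_of_int \<lfloor>t * real (Suc k)\<rfloor> / real (Suc k)"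
  have [measurable]: "X t \<in> borel_measurable M" for t
    using assms by (simp add: random_path_def)
  show "(\<lambda>p. X (?d k (snd p)) (fst p)) \<in> borel_measurable (M \<Otimes>\<^sub>M lborel)" for k
  proof (rule measurable_compose_countable[where f = "\<lambda>i p. X (real_of_int i / real (Suc k)) (fst p)"])
    show "(\<lambda>p. \<lfloor>snd p * real (Suc k)\<rfloor>) \<in> M \<Otimes>\<^sub>M lborel \<rightarrow>\<^sub>M count_space UNIV"
      by measurable
  qed measurable
  fix p assume "p \<in> space (M \<Otimes>\<^sub>M (lborel :: real measure))"
  then have cont: "continuous_on UNIV (\<lambda>t. X t (fst p))"
    using assms by (auto simp: random_path_def space_pair_measure)
  have "(\<lambda>k. ?d k (snd p)) \<longlonglongrightarrow> snd p"
  proof (rule tendsto_sandwich)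
    have "snd p - 1 / real (Suc k) \<le> ?d k (snd p)" "?d k (snd p) \<le> snd p" for k
    proof -
      have "(snd p * real (Suc k) - 1) / real (Suc k) \<le> ?d k (snd p)"
        "?d k (snd p) \<le> snd p * real (Suc k) / real (Suc k)"
        by (intro divide_right_mono; linarith)+
      then show "snd p - 1 / real (Suc k) \<le> ?d k (snd p)" "?d k (snd p) \<le> snd p"
        by (simp_all add: diff_divide_distrib del: of_nat_Suc)
    qed
    then show "\<forall>\<^sub>F k in sequentially. snd p - 1 / real (Suc k) \<le> ?d k (snd p)"
      "\<forall>\<^sub>F k in sequentially. ?d k (snd p) \<le> snd p"
      by simp_all
    show "(\<lambda>k. snd p - 1 / real (Suc k)) \<longlonglongrightarrow> snd p"
      using tendsto_diff[OF tendsto_const[of "snd p"] LIMSEQ_inverse_real_of_nat] by (simp add: inverse_eq_divide)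
  qed simp
  from continuous_on_tendsto_compose[OF cont this]
  show "(\<lambda>k. X (?d k (snd p)) (fst p)) \<longlonglongrightarrow> (case p of (\<omega>, t) \<Rightarrow> X t \<omega>)"
    by (simp add: split_def)
qed

lemma random_path_mult: "random_path M X \<Longrightarrow> random_path M Y \<Longrightarrow> random_path M (\<lambda>t \<omega>. X t \<omega> * Y t \<omega>)"
  and random_path_diff: "random_path M X \<Longrightarrow> random_path M Y \<Longrightarrow> random_path M (\<lambda>t \<omega>. X t \<omega> - Y t \<omega>)"
  and random_path_abs: "random_path M X \<Longrightarrow> random_path M (\<lambda>t \<omega>. \<bar>X t \<omega>\<bar>)"
  by (auto simp: random_path_def intro!: continuous_intros borel_measurable_times borel_measurable_diff borel_measurable_abs)

lemma random_path_sum: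
  "(\<And>i. i \<in> A \<Longrightarrow> random_path M (X i)) \<Longrightarrow> random_path M (\<lambda>t \<omega>. \<Sum>i\<in>A. X i t \<omega>)"
  by (auto simp: random_path_def intro!: continuous_intros borel_measurable_sum)

lemma random_path_deterministic: "continuous_on UNIV f \<Longrightarrow> random_path M (\<lambda>t \<omega>. f t)"
  by (simp add: random_path_def)

lemma random_path_volterra:
  fixes k :: "real \<Rightarrow> real \<Rightarrow> real"
  assumes k: "continuous_on UNIV (\<lambda>(t, s). k t s)" and X: "random_path M X"
  shows "random_path M (\<lambda>t \<omega>. LBINT s=0..t. k t s * X s \<omega>)"
  unfolding random_path_def
proof (intro conjI ballI allI)
  fix \<omega> assume "\<omega> \<in> space M"
  then have "continuous_on UNIV (\<lambda>t. X t \<omega>)" using X by (simp add: random_path_def)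
  then have "continuous_on UNIV (\<lambda>p::real \<times> real. X (snd p) \<omega>)"
    by (rule continuous_on_compose2) (auto intro: continuous_intros)
  then show "continuous_on UNIV (\<lambda>t::real. LBINT s=0..t. k t s * X s \<omega>)"
    using k by (intro continuous_on_volterra) (auto simp: split_def intro!: continuous_intros)
next
  fix t :: real
  note [measurable] = random_path_joint_measurable[OF X]
  have "continuous_on UNIV (k t)"
    using continuous_on_compose2[OF k, of UNIV "\<lambda>s. (t, s)"]
    by (simp add: continuous_on_Pair)
  then have [measurable]: "k t \<in> borel_measurable borel" by (rule borel_measurable_continuous_onI)
  have "(\<lambda>\<omega>. LBINT s:A. k t s * X s \<omega>) \<in> borel_measurable M" if [measurable]: "A \<in> sets borel" for A
  proof -
    have "(\<lambda>(\<omega>, s). indicator A s *\<^sub>R (k t s * X s \<omega>)) \<in> borel_measurable (M \<Otimes>\<^sub>M lborel)"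
      using random_path_joint_measurable[OF X] unfolding split_def by measurable
    then show ?thesis
      unfolding set_lebesgue_integral_def by (rule lborel.borel_measurable_lebesgue_integral)
  qed
  then show "(\<lambda>\<omega>. LBINT s=0..t. k t s * X s \<omega>) \<in> borel_measurable M"
    unfolding interval_lebesgue_integral_def by (cases "0 \<le> ereal t") auto
qed

lemma random_path_x_proc:
  assumes w: "continuous_on UNIV w1" "continuous_on UNIV w2"
    and I: "random_path M I1" "random_path M I2" and "1 \<le> n"
  shows "random_path M (x_proc x0 w1 w2 I1 I2 n)"
  using \<open>1 \<le> n\<close>
proof (induction n rule: less_induct)
  case (less n)
  consider "n = Suc 0" | m where "n = Suc (Suc m)"
    using less.prems(1) by (metis not0_implies_Suc One_nat_def not_one_le_zero)
  then show ?case
  proof cases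
    case 1
    have "random_path M (\<lambda>t \<omega>. w2 t * I1 t \<omega> - w1 t * I2 t \<omega>)"
      by (intro random_path_diff random_path_mult random_path_deterministic w I)
    then show ?thesis by (simp add: 1 random_path_def)
  next
    case 2
    let ?x = "x_proc x0 w1 w2 I1 I2"
    have "random_path M (\<lambda>t \<omega>. LBINT s=0..t. kernel_K w1 w2 t s * (\<Sum>j=1..Suc m. ?x j s \<omega> * ?x (Suc (Suc m) - j) s \<omega>))"
      by (intro random_path_volterra random_path_sum random_path_mult less.IH)
        (auto simp: 2 split_def intro!: continuous_on_kernel[OF w] continuous_intros)
    then show ?thesis by (simp add: 2 random_path_def del: sum.cl_ivl_Suc)
  qed
qed

text \<open>By continuity it suffices to test countably many times: the rationals, projected to \<open>{0..T}\<close>.\<close>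
lemma random_path_nonneg_event:
  assumes X: "random_path M X" and "0 \<le> T"
  shows "{\<omega> \<in> space M. \<forall>t\<in>{0..T}. 0 \<le> X t \<omega>} \<in> sets M"
proof -
  have [measurable]: "X t \<in> borel_measurable M" for t
    using X by (simp add: random_path_def)
  have "(\<forall>t\<in>{0..T}. 0 \<le> X t \<omega>) \<longleftrightarrow> (\<forall>r::rat. 0 \<le> X (max 0 (min T (of_rat r))) \<omega>)" if "\<omega> \<in> space M" for \<omega>
  proof
    assume R: "\<forall>r::rat. 0 \<le> X (max 0 (min T (of_rat r))) \<omega>"
    have "continuous_on UNIV (\<lambda>t. X t \<omega>)" using X that by (simp add: random_path_def)
    then have "continuous_on UNIV (\<lambda>t. X (max 0 (min T t)) \<omega>)"
      by (rule continuous_on_compose2) (auto intro!: continuous_on_max continuous_on_min continuous_intros)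
    then have "0 \<le> X (max 0 (min T t)) \<omega>" for t
      using R by (intro continuous_ge_on_closure[of \<rat> "\<lambda>t. X (max 0 (min T t)) \<omega>" t 0])
        (auto simp: Rats_closure_real elim!: Rats_cases)
    then show "\<forall>t\<in>{0..T}. 0 \<le> X t \<omega>"
      by (metis atLeastAtMost_iff max.absorb2 min.absorb2)
  qed (use \<open>0 \<le> T\<close> in auto)
  then have "{\<omega> \<in> space M. \<forall>t\<in>{0..T}. 0 \<le> X t \<omega>} = {\<omega> \<in> space M. \<forall>r::rat. 0 \<le> X (max 0 (min T (of_rat r))) \<omega>}"
    by blast
  then show ?thesis by simp
qed

lemma x_proc_cong:
  assumes "\<And>t. 0 \<le> t \<Longrightarrow> I1 t \<omega> = J1 t \<omega>" "\<And>t. 0 \<le> t \<Longrightarrow> I2 t \<omega> = J2 t \<omega>"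
  shows "0 \<le> t \<Longrightarrow> x_proc x0 w1 w2 I1 I2 n t \<omega> = x_proc x0 w1 w2 J1 J2 n t \<omega>"
proof (induction n arbitrary: t rule: less_induct)
  case (less n)
  consider "n = 0" | "n = Suc 0" | m where "n = Suc (Suc m)"
    by (metis not0_implies_Suc)
  then show ?case
  proof cases
    case 3
    have "(\<Sum>j=1..Suc m. x_proc x0 w1 w2 I1 I2 j s \<omega> * x_proc x0 w1 w2 I1 I2 (Suc (Suc m) - j) s \<omega>)
      = (\<Sum>j=1..Suc m. x_proc x0 w1 w2 J1 J2 j s \<omega> * x_proc x0 w1 w2 J1 J2 (Suc (Suc m) - j) s \<omega>)"
      if "0 \<le> s" for s
      using that by (intro sum.cong arg_cong2[where f = "(*)"] less.IH) (auto simp: 3)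
    then show ?thesis
      using less.prems unfolding 3 x_proc.simps
      by (intro interval_integral_cong) (auto simp: einterval_iff zero_ereal_def min_def simp del: sum.cl_ivl_Suc)
  qed (use assms less.prems in auto)
qed

text \<open>The measure of a set that is not measurable is 0 by convention, so measurability of the event is
  part of the claim. The paths of \<open>I1\<close> and \<open>I2\<close> are continuous only outside a null set \<open>Z\<close> and on
  \<open>{0..}\<close>. Both are replaced by processes that are 0 on \<open>Z\<close> and constant before time 0; the event
  changes only inside \<open>Z\<close>, where completeness of the measure applies.\<close>
lemma X_approx_event_measurable:
  assumes "complete_measure M" and w: "continuous_on UNIV w1" "continuous_on UNIV w2"
    and meas: "\<And>t. 0 \<le> t \<Longrightarrow> I1 t \<in> borel_measurable M" "\<And>t. 0 \<le> t \<Longrightarrow> I2 t \<in> borel_measurable M"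
    and Z: "Z \<in> null_sets M"
    and cont: "\<And>\<omega>. \<omega> \<in> space M - Z \<Longrightarrow> continuous_on {0..} (\<lambda>t. I1 t \<omega>)"
      "\<And>\<omega>. \<omega> \<in> space M - Z \<Longrightarrow> continuous_on {0..} (\<lambda>t. I2 t \<omega>)"
    and "0 \<le> T"
  shows "{\<omega> \<in> space M. \<forall>t\<in>{0..T}. \<bar>X_approx x0 w1 w2 I1 I2 \<sigma> n t \<omega> - x0 t\<bar> \<le> Gamma_sum w1 w2 n t} \<in> sets M"
    (is "?E \<in> sets M")
proof -
  have [measurable]: "Z \<in> sets M" using Z by auto
  let ?J = "\<lambda>I t \<omega>. indicator (space M - Z) \<omega> * I (max 0 t) \<omega> :: real"
  have J: "random_path M (?J I)"
    if meas: "\<And>t. 0 \<le> t \<Longrightarrow> I t \<in> borel_measurable M"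
      and cont: "\<And>\<omega>. \<omega> \<in> space M - Z \<Longrightarrow> continuous_on {0..} (\<lambda>t. I t \<omega>)" for I
    unfolding random_path_def
  proof (intro conjI ballI allI)
    fix \<omega> assume "\<omega> \<in> space M"
    show "continuous_on UNIV (\<lambda>t. ?J I t \<omega>)"
    proof (cases "\<omega> \<in> Z")
      case False
      with cont[of \<omega>] \<open>\<omega> \<in> space M\<close> have "continuous_on {0..} (\<lambda>t. I t \<omega>)" by blast
      then have "continuous_on UNIV (\<lambda>t. I (max 0 t) \<omega>)"
        by (rule continuous_on_compose2) (auto intro!: continuous_on_max continuous_intros)
      then show ?thesis by (intro continuous_intros)
    qed simp
  next
    fix t
    have [measurable]: "I (max 0 t) \<in> borel_measurable M" by (rule meas) simp
    show "?J I t \<in> borel_measurable M" by measurable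
  qed
  let ?x = "x_proc x0 w1 w2 (?J I1) (?J I2)"
  have "random_path M (\<lambda>t \<omega>. Gamma_sum w1 w2 n t - \<bar>\<Sum>i=1..n. \<sigma> ^ i * ?x i t \<omega>\<bar>)"
    unfolding Gamma_sum_def
    by (intro random_path_diff random_path_abs random_path_sum random_path_mult random_path_deterministic
        random_path_x_proc[OF w J J] continuous_on_gamma_fun[OF w] continuous_on_const meas cont) auto
  from random_path_nonneg_event[OF this \<open>0 \<le> T\<close>]
  have E': "{\<omega> \<in> space M. \<forall>t\<in>{0..T}. 0 \<le> Gamma_sum w1 w2 n t - \<bar>\<Sum>i=1..n. \<sigma> ^ i * ?x i t \<omega>\<bar>} \<in> sets M"
    (is "?E' \<in> _") .
  have "X_approx x0 w1 w2 I1 I2 \<sigma> n t \<omega> - x0 t = (\<Sum>i=1..n. \<sigma> ^ i * ?x i t \<omega>)"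
    if "\<omega> \<in> space M - Z" "0 \<le> t" for t \<omega>
  proof -
    have "x_proc x0 w1 w2 I1 I2 i t \<omega> = ?x i t \<omega>" for i
      using that by (intro x_proc_cong) auto
    then show ?thesis
      unfolding X_approx_def by (simp add: sum.atLeast_Suc_atMost)
  qed
  then have "\<omega> \<in> ?E \<longleftrightarrow> \<omega> \<in> ?E'" if "\<omega> \<notin> Z" for \<omega>
    using that by (simp cong: conj_cong)
  then have E_eq: "?E = (?E' - Z) \<union> (?E \<inter> Z)" by blast
  have "?E \<inter> Z \<in> sets M"
    by (rule complete_measure.complete[OF assms(1) _ Z]) blast
  moreover have "?E' - Z \<in> sets M"
    by (rule sets.Diff[OF E' \<open>Z \<in> sets M\<close>])
  ultimately have "(?E' - Z) \<union> (?E \<inter> Z) \<in> sets M"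
    by (rule sets.Un[rotated])
  then show ?thesis by (rule ssubst[OF E_eq, where P = "\<lambda>S. S \<in> sets M"])
qed

section \<open>Maximal inequality for the stochastic integral\<close>

text \<open>The step integrals over the initial cells are partial sums of independent centred variables.\<close>
lemma step_integral_maximal_inequality:
  fixes \<mu> :: real
  assumes bm: "brownian_motion M B" and f: "continuous_on UNIV f"
    and p0: "p 0 = 0" and p: "\<And>i. i < N \<Longrightarrow> p i < p (Suc i)"
    and v: "\<And>i s. i < N \<Longrightarrow> p i \<le> s \<Longrightarrow> s \<le> p (Suc i) \<Longrightarrow> \<bar>v i\<bar> \<le> \<bar>f s\<bar>"
    and "0 \<le> \<mu>" "0 \<le> p N"
  shows "\<mu> * measure M {\<omega> \<in> space M. \<exists>j\<in>{..N}. \<mu> < \<bar>step_integral B j p v \<omega>\<bar>}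
    \<le> sqrt (2 / pi) * L2_norm_on (p N) f"
proof -
  interpret prob_space M using bm by (simp add: brownian_motion_def)
  let ?X = "\<lambda>i \<omega>. v i * (B (p (Suc i)) \<omega> - B (p i) \<omega>)"
  have part: "is_partition (p N) N p"
    using p0 p by (simp add: is_partition_def less_imp_le)
  have pn: "0 \<le> p i" if "i < N" for i
    using is_partition_nonneg[OF part] that by simp
  have "indep_vars (\<lambda>_. borel) (\<lambda>i \<omega>. B (p (Suc i)) \<omega> - B (p i) \<omega>) {..<N}"
    using p by (intro brownian_indep_increments[where p = p, OF bm]) (auto intro: less_imp_le simp: p0)
  then have "indep_vars (\<lambda>_. borel) ?X {..<N}"
    by (intro indep_vars_compose2[where Y = "\<lambda>i x. v i * x"]) auto
  moreover have "integrable M (?X i)" "expectation (?X i) = 0" if "i < N" for i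
    using brownian_increment[OF bm pn[OF that] less_imp_le[OF p[OF that]]] by simp_all
  ultimately have "\<mu> * prob {\<omega> \<in> space M. \<exists>j\<in>{..N}. \<mu> < \<bar>\<Sum>i<j. ?X i \<omega>\<bar>}
      \<le> expectation (\<lambda>\<omega>. \<bar>\<Sum>i<N. ?X i \<omega>\<bar>)"
    using \<open>0 \<le> \<mu>\<close> by (intro indep_sums_maximal_inequality) auto
  also have "\<dots> = sqrt (2 / pi) * sqrt (\<Sum>i<N. (v i)\<^sup>2 * (p (Suc i) - p i))"
    using expectation_abs_step_integral[OF bm, of p N v] p0 p by (simp add: step_integral_def)
  also have "\<dots> \<le> sqrt (2 / pi) * sqrt (LBINT s=0..p N. (f s)\<^sup>2)"
    using weighted_square_sum_le_integral[where p = p and N = N and v = v, OF f p0] p v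
    by (intro mult_left_mono real_sqrt_le_mono) (auto intro: less_imp_le)
  also have "(LBINT s=0..p N. (f s)\<^sup>2) = (LBINT s:{0..p N}. (f s)\<^sup>2)"
    using \<open>0 \<le> p N\<close> by (simp add: interval_integral_Icc zero_ereal_def)
  finally show ?thesis
    by (simp add: step_integral_def L2_norm_on_def)
qed

text \<open>On each cell of a fine uniform grid the value is taken at a point where \<open>|f|\<close> is minimal. By uniform
  continuity it is close to \<open>f\<close>, and it is dominated by \<open>|f|\<close>. The number of cells is a multiple of \<open>n\<close>,
  which makes the points of the coarse grid of \<open>n\<close> cells available as partition points.\<close>
lemma fine_step_approximation:
  fixes f :: "real \<Rightarrow> real"
  assumes f: "continuous_on UNIV f" and "0 < T" "0 < e" "1 \<le> n"
  obtains k :: nat and v :: "nat \<Rightarrow> real" where "1 \<le> k"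
    and "\<And>i s. i < n * k \<Longrightarrow> real i * (T / real (n * k)) \<le> s \<Longrightarrow> s \<le> real (Suc i) * (T / real (n * k))
        \<Longrightarrow> \<bar>v i\<bar> \<le> \<bar>f s\<bar>"
    and "\<And>i s. i < n * k \<Longrightarrow> real i * (T / real (n * k)) \<le> s \<Longrightarrow> s \<le> real (Suc i) * (T / real (n * k))
        \<Longrightarrow> \<bar>f s - v i\<bar> \<le> e"
proof -
  have "uniformly_continuous_on {0..T} f"
    by (intro compact_uniformly_continuous continuous_on_subset[OF f]) auto
  with \<open>0 < e\<close> obtain d where "0 < d"
    and d: "\<And>x y. x \<in> {0..T} \<Longrightarrow> y \<in> {0..T} \<Longrightarrow> dist y x < d \<Longrightarrow> dist (f y) (f x) < e"
    unfolding uniformly_continuous_on_def by metis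
  obtain k :: nat where k: "T / d < real k" using reals_Archimedean2 by blast
  with \<open>0 < T\<close> \<open>0 < d\<close> have "1 \<le> k"
    by (metis One_nat_def Suc_leI divide_pos_pos of_nat_0_less_iff order.strict_trans)
  define h where "h = T / real (n * k)"
  have K: "1 \<le> n * k" using \<open>1 \<le> n\<close> \<open>1 \<le> k\<close> by (metis mult_le_mono nat_mult_1)
  then have "0 < real (n * k)" by simp
  have "0 < h" unfolding h_def using \<open>0 < T\<close> \<open>0 < real (n * k)\<close> by (rule divide_pos_pos)
  have "h \<le> T / real k"
    unfolding h_def using \<open>1 \<le> n\<close> \<open>1 \<le> k\<close> \<open>0 < T\<close> by (intro divide_left_mono) auto
  also have "\<dots> < d" using k \<open>0 < d\<close> \<open>1 \<le> k\<close> by (simp add: field_simps)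
  finally have "h < d" .
  let ?C = "\<lambda>i::nat. {real i * h..real (Suc i) * h}"
  have "\<exists>x\<in>?C i. \<forall>s\<in>?C i. \<bar>f x\<bar> \<le> \<bar>f s\<bar>" for i
    using \<open>0 < h\<close> by (intro continuous_attains_inf continuous_intros continuous_on_subset[OF f]) auto
  then obtain \<xi> where \<xi>: "\<And>i. \<xi> i \<in> ?C i" "\<And>i s. s \<in> ?C i \<Longrightarrow> \<bar>f (\<xi> i)\<bar> \<le> \<bar>f s\<bar>"
    by metis
  have C: "x \<in> {0..T}" if "x \<in> ?C i" "i < n * k" for x i
  proof -
    have "real (Suc i) \<le> real (n * k)"
      using that(2) by (simp only: of_nat_le_iff Suc_le_eq)
    then have "real (Suc i) * h \<le> real (n * k) * h"
      using \<open>0 < h\<close> by (intro mult_right_mono) auto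
    also have "\<dots> = T" unfolding h_def using \<open>0 < real (n * k)\<close> by (simp only: nonzero_mult_div_cancel_left times_divide_eq_right)
    finally show ?thesis using that \<open>0 < h\<close> by (auto intro: order_trans[rotated])
  qed
  have close: "\<bar>f s - f (\<xi> i)\<bar> \<le> e" if "s \<in> ?C i" "i < n * k" for s i
  proof -
    have "dist s (\<xi> i) \<le> h"
      using that(1) \<xi>(1)[of i] by (auto simp: dist_real_def algebra_simps)
    then have "dist (f s) (f (\<xi> i)) < e"
      using d[OF C[OF \<xi>(1) that(2)] C[OF that]] \<open>h < d\<close> by simp
    then show ?thesis by (simp add: dist_real_def)
  qed
  show ?thesis
    by (rule that[of k "\<lambda>i. f (\<xi> i)"]) (use \<open>1 \<le> k\<close> \<xi>(2) close in \<open>auto simp: h_def\<close>)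
qed

lemma stoch_integral_approx_probability:
  fixes d :: real
  assumes bm: "brownian_motion M B" and J: "is_stoch_integral M B f t J"
    and f: "f \<in> borel_measurable borel" and p: "is_partition t N p"
    and close: "\<And>s. 0 < s \<Longrightarrow> s \<le> t \<Longrightarrow> \<bar>f s - step_fun N p v s\<bar> \<le> e" and "0 \<le> e" "0 < d" "0 \<le> t"
  shows "measure M {\<omega> \<in> space M. d \<le> \<bar>J \<omega> - step_integral B N p v \<omega>\<bar>} \<le> 4 * e\<^sup>2 * t / d\<^sup>2"
proof -
  interpret prob_space M using bm by (simp add: brownian_motion_def)
  have [measurable]: "J \<in> borel_measurable M" using J by (simp add: is_stoch_integral_def)
  note [measurable] = step_integral_measurable[OF bm p]
  let ?D = "\<lambda>\<omega>. J \<omega> - step_integral B N p v \<omega>"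
  have "(\<integral>\<^sup>+ s\<in>{0..t}. ennreal ((f s - step_fun N p v s)\<^sup>2) \<partial>lborel)
      \<le> (\<integral>\<^sup>+ s. ennreal (e\<^sup>2) * indicator {0..t} s \<partial>lborel)"
  proof (rule nn_integral_mono_AE)
    \<comment> \<open>At \<open>s = 0\<close> the step function is 0, whatever \<open>f 0\<close> is.\<close>
    have "AE s in lborel. s \<noteq> (0::real)" by (rule AE_lborel_singleton)
    then show "AE s in lborel. ennreal ((f s - step_fun N p v s)\<^sup>2) * indicator {0..t} s
        \<le> ennreal (e\<^sup>2) * indicator {0..t} s"
    proof (rule AE_mp, intro AE_I2 impI)
      fix s :: real assume "s \<noteq> 0"
      then show "ennreal ((f s - step_fun N p v s)\<^sup>2) * indicator {0..t} s \<le> ennreal (e\<^sup>2) * indicator {0..t} s"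
        using close[of s] \<open>0 \<le> e\<close>
        by (auto split: split_indicator intro!: ennreal_leI simp: abs_le_square_iff[symmetric])
    qed
  qed
  also have "\<dots> = ennreal (e\<^sup>2 * t)"
    using \<open>0 \<le> t\<close> by (simp add: nn_integral_cmult_indicator ennreal_mult)
  finally have L2: "(\<integral>\<^sup>+ \<omega>. ennreal ((?D \<omega>)\<^sup>2) \<partial>M) \<le> 4 * ennreal (e\<^sup>2 * t)"
    by (intro order_trans[OF stoch_integral_step_distance[OF bm J f p]] mult_left_mono) auto
  have "{\<omega> \<in> space M. d \<le> \<bar>?D \<omega>\<bar>} = {\<omega> \<in> space M. 1 \<le> ennreal (1 / d\<^sup>2) * ennreal ((?D \<omega>)\<^sup>2)}"
  proof -
    have "d \<le> \<bar>x\<bar> \<longleftrightarrow> 1 \<le> ennreal (1 / d\<^sup>2) * ennreal (x\<^sup>2)" for x :: real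
    proof -
      have "d \<le> \<bar>x\<bar> \<longleftrightarrow> d\<^sup>2 \<le> x\<^sup>2" using \<open>0 < d\<close> by (simp add: abs_le_square_iff[symmetric])
      also have "\<dots> \<longleftrightarrow> 1 \<le> 1 / d\<^sup>2 * x\<^sup>2" using \<open>0 < d\<close> by (simp add: field_simps)
      also have "\<dots> \<longleftrightarrow> 1 \<le> ennreal (1 / d\<^sup>2) * ennreal (x\<^sup>2)"
        by (simp add: ennreal_mult[symmetric] del: ennreal_1 flip: ennreal_1)
      finally show ?thesis .
    qed
    then show ?thesis by simp
  qed
  then have "emeasure M {\<omega> \<in> space M. d \<le> \<bar>?D \<omega>\<bar>} \<le> ennreal (1 / d\<^sup>2) * (\<integral>\<^sup>+ \<omega>\<in>space M. ennreal ((?D \<omega>)\<^sup>2) \<partial>M)"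
    by (simp only:) (rule nn_integral_Markov_inequality; measurable)
  also have "(\<integral>\<^sup>+ \<omega>\<in>space M. ennreal ((?D \<omega>)\<^sup>2) \<partial>M) = (\<integral>\<^sup>+ \<omega>. ennreal ((?D \<omega>)\<^sup>2) \<partial>M)"
    by (intro nn_integral_cong) simp
  also have "ennreal (1 / d\<^sup>2) * \<dots> \<le> ennreal (1 / d\<^sup>2) * (4 * ennreal (e\<^sup>2 * t))"
    by (intro mult_left_mono L2) simp
  also have "\<dots> = ennreal (4 * e\<^sup>2 * t / d\<^sup>2)"
    using \<open>0 \<le> t\<close> by (simp add: ennreal_mult[symmetric] flip: ennreal_numeral)
  finally show ?thesis
    using \<open>0 \<le> t\<close> by (simp add: emeasure_eq_measure ennreal_le_iff)
qed

text \<open>If \<open>|I|\<close> exceeds \<open>\<mu>\<close> at a grid point, then the step integral exceeds a smaller level \<open>\<nu>\<close> at the same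
  point, unless it is at distance at least \<open>\<mu> - \<nu>\<close> from \<open>I\<close>. The latter has arbitrarily small probability \<open>\<eta>\<close> for a
  fine partition, the former is covered by the inequality for step integrals; then \<open>\<eta> \<rightarrow> 0\<close> and
  \<open>\<nu> \<rightarrow> \<mu>\<close>.\<close>
lemma stoch_integral_grid_maximal_inequality:
  fixes I :: "real \<Rightarrow> 'a \<Rightarrow> real" and \<mu> :: real
  assumes bm: "brownian_motion M B" and I: "\<And>t. 0 \<le> t \<Longrightarrow> is_stoch_integral M B f t (I t)"
    and f: "continuous_on UNIV f" and "0 < T" "0 < \<mu>" "1 \<le> n"
  shows "\<mu> * measure M {\<omega> \<in> space M. \<exists>j\<in>{..n}. \<mu> < \<bar>I (real j * T / real n) \<omega>\<bar>}
    \<le> sqrt (2 / pi) * L2_norm_on T f"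
proof -
  interpret prob_space M using bm by (simp add: brownian_motion_def)
  let ?C = "sqrt (2 / pi) * L2_norm_on T f"
  let ?t = "\<lambda>j. real j * T / real n"
  let ?A = "{\<omega> \<in> space M. \<exists>j\<in>{..n}. \<mu> < \<bar>I (?t j) \<omega>\<bar>}"
  have fm: "f \<in> borel_measurable borel" by (rule borel_measurable_continuous_onI[OF f])
  have t0: "0 \<le> ?t j" for j using \<open>0 < T\<close> by simp
  have [measurable]: "I (?t j) \<in> borel_measurable M" for j
    using I[OF t0] by (simp add: is_stoch_integral_def)
  have ineq: "\<nu> * prob ?A \<le> ?C + \<nu> * \<eta>" if "0 < \<nu>" "\<nu> < \<mu>" "0 < \<eta>" for \<nu> \<eta> :: real
  proof -
    define d where "d = \<mu> - \<nu>"
    have "0 < d" using that by (simp add: d_def)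
    \<comment> \<open>Chosen so that Chebyshev's bound, summed over the \<open>n + 1\<close> grid points, is \<open>\<eta>\<close>.\<close>
    define e where "e = sqrt (\<eta> * d\<^sup>2 / (4 * T * real (Suc n)))"
    have "0 < e" using that \<open>0 < T\<close> \<open>0 < d\<close> by (simp add: e_def)
    have e2: "4 * e\<^sup>2 * T / d\<^sup>2 * real (Suc n) = \<eta>"
      using that \<open>0 < T\<close> \<open>0 < d\<close> by (simp add: e_def field_simps del: of_nat_Suc)
    obtain k v where "1 \<le> k"
      and v: "\<And>i s. i < n * k \<Longrightarrow> real i * (T / real (n * k)) \<le> s \<Longrightarrow> s \<le> real (Suc i) * (T / real (n * k))
          \<Longrightarrow> \<bar>v i\<bar> \<le> \<bar>f s\<bar>"
      and ve: "\<And>i s. i < n * k \<Longrightarrow> real i * (T / real (n * k)) \<le> s \<Longrightarrow> s \<le> real (Suc i) * (T / real (n * k))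
          \<Longrightarrow> \<bar>f s - v i\<bar> \<le> e"
      using fine_step_approximation[OF f \<open>0 < T\<close> \<open>0 < e\<close> \<open>1 \<le> n\<close>] by metis
    define p where "p i = real i * (T / real (n * k))" for i
    have v_p: "\<bar>v i\<bar> \<le> \<bar>f s\<bar>" and ve_p: "\<bar>f s - v i\<bar> \<le> e"
      if "i < n * k" "p i \<le> s" "s \<le> p (Suc i)" for i s
      using v[OF that[unfolded p_def]] ve[OF that[unfolded p_def]] by blast+
    have h: "0 < T / real (n * k)" using \<open>0 < T\<close> \<open>1 \<le> k\<close> \<open>1 \<le> n\<close> by simp
    have p0: "p 0 = 0" by (simp add: p_def)
    have p_mono: "p i < p (Suc i)" for i using h unfolding p_def by (intro mult_strict_right_mono) auto
    have p_grid: "p (j * k) = ?t j" for j using \<open>1 \<le> k\<close> by (simp add: p_def)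
    have pN: "p (n * k) = T" using p_grid[of n] \<open>1 \<le> n\<close> by simp
    let ?S = "\<lambda>j. step_integral B (j * k) p v"
    let ?D = "{\<omega> \<in> space M. \<exists>j\<in>{..n * k}. \<nu> < \<bar>step_integral B j p v \<omega>\<bar>}"
    let ?R = "\<lambda>j. {\<omega> \<in> space M. d \<le> \<bar>I (?t j) \<omega> - ?S j \<omega>\<bar>}"
    have part: "is_partition (p j) j p" for j
      using p0 p_mono by (simp add: is_partition_def less_imp_le)
    have [measurable]: "step_integral B j p v \<in> borel_measurable M" for j
      by (rule step_integral_measurable[OF bm part])
    have small: "prob (?R j) \<le> 4 * e\<^sup>2 * T / d\<^sup>2" if "j \<le> n" for j
    proof -
      have "j * k \<le> n * k" using that by simp
      have "?t j \<le> T" using that \<open>0 < T\<close> \<open>1 \<le> n\<close> by (simp add: field_simps)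
      have "prob (?R j) \<le> 4 * e\<^sup>2 * ?t j / d\<^sup>2"
      proof (rule stoch_integral_approx_probability[OF bm I[OF t0] fm])
        show "is_partition (?t j) (j * k) p" using part[of "j * k"] by (simp add: p_grid)
        fix s assume s: "0 < s" "s \<le> ?t j"
        show "\<bar>f s - step_fun (j * k) p v s\<bar> \<le> e"
          using s \<open>j * k \<le> n * k\<close>
          by (intro step_fun_approximates ve_p order.strict_trans2[OF _ \<open>j * k \<le> n * k\<close>] less_imp_le[OF p_mono]) (auto simp: p0 p_grid)
      qed (use \<open>0 < e\<close> \<open>0 < d\<close> t0 in auto)
      also have "\<dots> \<le> 4 * e\<^sup>2 * T / d\<^sup>2"
        using \<open>?t j \<le> T\<close> by (intro divide_right_mono mult_left_mono) auto
      finally show ?thesis .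
    qed
    have "?A \<subseteq> ?D \<union> (\<Union>j\<in>{..n}. ?R j)"
    proof
      fix \<omega> assume "\<omega> \<in> ?A"
      then obtain j where j: "\<omega> \<in> space M" "j \<le> n" "\<mu> < \<bar>I (?t j) \<omega>\<bar>" by auto
      show "\<omega> \<in> ?D \<union> (\<Union>j\<in>{..n}. ?R j)"
      proof (cases "d \<le> \<bar>I (?t j) \<omega> - ?S j \<omega>\<bar>")
        case False
        with j have "\<nu> < \<bar>?S j \<omega>\<bar>" by (simp add: d_def)
        moreover have "j * k \<in> {..n * k}" using j by simp
        ultimately show ?thesis using j(1) by blast
      qed (use j in auto)
    qed
    then have "prob ?A \<le> prob (?D \<union> (\<Union>j\<in>{..n}. ?R j))"
      by (intro finite_measure_mono) measurable
    also have "\<dots> \<le> prob ?D + prob (\<Union>j\<in>{..n}. ?R j)"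
      by (intro measure_Un_le) measurable
    also have "prob (\<Union>j\<in>{..n}. ?R j) \<le> (\<Sum>j\<in>{..n}. prob (?R j))"
      by (intro finite_measure_subadditive_finite) auto
    also have "\<dots> \<le> (\<Sum>j\<in>{..n}. 4 * e\<^sup>2 * T / d\<^sup>2)"
      by (intro sum_mono small) simp
    also have "\<dots> = \<eta>" using e2 by (simp add: mult.commute)
    finally have "\<nu> * prob ?A \<le> \<nu> * (prob ?D + \<eta>)"
      using \<open>0 < \<nu>\<close> by (intro mult_left_mono) auto
    moreover have "\<nu> * prob ?D \<le> ?C"
      using step_integral_maximal_inequality[where p = p and N = "n * k" and v = v and \<mu> = \<nu>,
          OF bm f p0 p_mono v_p] \<open>0 < \<nu>\<close> \<open>0 < T\<close>
      by (simp add: pN)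
    ultimately show ?thesis by (simp add: distrib_left)
  qed
  have "\<nu> * prob ?A \<le> ?C" if "0 < \<nu>" "\<nu> < \<mu>" for \<nu>
  proof (rule field_le_epsilon)
    fix x :: real assume "0 < x"
    then show "\<nu> * prob ?A \<le> ?C + x" using ineq[OF that, of "x / \<nu>"] that by simp
  qed
  then show ?thesis
    using \<open>0 < \<mu>\<close> by (intro tendsto_upperbound[of "\<lambda>\<nu>. \<nu> * prob ?A" "\<mu> * prob ?A" "at_left \<mu>"])
      (auto intro!: tendsto_intros simp: eventually_at_left[of 0 \<mu>])
qed

lemma dyadic_bound_continuous:
  fixes g :: "real \<Rightarrow> real"
  assumes g: "continuous_on {0..} g" and "0 < T"
    and le: "\<And>m j. j \<le> 2 ^ m \<Longrightarrow> \<bar>g (real j * T / real (2 ^ m))\<bar> \<le> \<mu>"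
    and t: "0 \<le> t" "t \<le> T"
  shows "\<bar>g t\<bar> \<le> \<mu>"
proof -
  \<comment> \<open>\<open>j m\<close> indexes the largest grid point of level \<open>m\<close> that is at most \<open>t\<close>.\<close>
  define j where "j m = nat \<lfloor>t / T * 2 ^ m\<rfloor>" for m :: nat
  have rj: "real (j m) = of_int \<lfloor>t / T * 2 ^ m\<rfloor>" for m
    using t \<open>0 < T\<close> by (simp add: j_def)
  have j_le: "j m \<le> 2 ^ m" for m
  proof -
    have "t / T * 2 ^ m \<le> 1 * 2 ^ m" using t \<open>0 < T\<close> by (intro mult_right_mono) auto
    with of_int_floor_le have "real_of_int \<lfloor>t / T * 2 ^ m\<rfloor> \<le> 1 * 2 ^ m"
      by (rule order_trans)
    then have "real (j m) \<le> real (2 ^ m)" unfolding rj by simp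
    then show ?thesis by (simp only: of_nat_le_iff)
  qed
  have "(\<lambda>m. real (j m) * T / real (2 ^ m)) \<longlonglongrightarrow> t"
  proof (rule tendsto_sandwich)
    show "(\<lambda>m. t - T * (1 / 2) ^ m) \<longlonglongrightarrow> t"
      using tendsto_diff[OF tendsto_const[of t] tendsto_mult[OF tendsto_const[of T] LIMSEQ_realpow_zero[of "1/2"]]] by simp
    have "t - T * (1 / 2) ^ m \<le> real (j m) * T / real (2 ^ m)" for m
    proof -
      have "t / T * 2 ^ m - 1 \<le> real (j m)" unfolding rj by linarith
      then have "(t / T * 2 ^ m - 1) * T / 2 ^ m \<le> real (j m) * T / 2 ^ m"
        using \<open>0 < T\<close> by (intro divide_right_mono mult_right_mono) auto
      moreover have "(t / T * 2 ^ m - 1) * T / 2 ^ m = t - T * (1 / 2) ^ m"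
        using \<open>0 < T\<close> by (simp add: field_simps power_divide)
      ultimately show ?thesis by simp
    qed
    then show "\<forall>\<^sub>F m in sequentially. t - T * (1 / 2) ^ m \<le> real (j m) * T / real (2 ^ m)" by simp
    have "real (j m) * T / real (2 ^ m) \<le> t" for m
    proof -
      have "real (j m) \<le> t / T * 2 ^ m" unfolding rj by linarith
      then show ?thesis using \<open>0 < T\<close> by (simp add: field_simps)
    qed
    then show "\<forall>\<^sub>F m in sequentially. real (j m) * T / real (2 ^ m) \<le> t" by simp
  qed simp
  then have "(\<lambda>m. \<bar>g (real (j m) * T / real (2 ^ m))\<bar>) \<longlonglongrightarrow> \<bar>g t\<bar>"
    using t \<open>0 < T\<close> by (intro tendsto_rabs continuous_on_tendsto_compose[OF g]) auto
  then show ?thesis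
    by (rule LIMSEQ_le_const2) (use le j_le in blast)
qed

text \<open>The grids are dyadic because these are nested: the exceedance events increase with the level, and
  continuity of the measure applies. Their union \<open>A\<close> is described by countably many times; for
  continuous paths it is the event that \<open>|I|\<close> exceeds \<open>\<mu>\<close> somewhere on \<open>{0..T}\<close>.\<close>
lemma stoch_integral_maximal_inequality:
  fixes I :: "real \<Rightarrow> 'a \<Rightarrow> real" and \<mu> :: real
  assumes bm: "brownian_motion M B" and I: "\<And>t. 0 \<le> t \<Longrightarrow> is_stoch_integral M B f t (I t)"
    and f: "continuous_on UNIV f" and "0 < T" "0 < \<mu>"
  shows "\<exists>A\<in>sets M. \<mu> * measure M A \<le> sqrt (2 / pi) * L2_norm_on T f \<and>
    (\<forall>\<omega>\<in>space M - A. continuous_on {0..} (\<lambda>t. I t \<omega>) \<longrightarrow> (\<forall>t\<in>{0..T}. \<bar>I t \<omega>\<bar> \<le> \<mu>))"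
proof -
  interpret prob_space M using bm by (simp add: brownian_motion_def)
  define A where "A m = {\<omega> \<in> space M. \<exists>j\<in>{..2 ^ m}. \<mu> < \<bar>I (real j * T / real (2 ^ m)) \<omega>\<bar>}" for m :: nat
  have [measurable]: "I (real j * T / real (2 ^ m)) \<in> borel_measurable M" for j m
    using I[of "real j * T / real (2 ^ m)"] \<open>0 < T\<close> by (simp add: is_stoch_integral_def)
  have A_sets [measurable]: "A m \<in> sets M" for m unfolding A_def by measurable
  have "A m \<subseteq> A (Suc m)" for m
  proof
    fix \<omega> assume "\<omega> \<in> A m"
    then obtain j where j: "\<omega> \<in> space M" "j \<le> 2 ^ m" "\<mu> < \<bar>I (real j * T / real (2 ^ m)) \<omega>\<bar>"
      by (auto simp: A_def)
    moreover have "real j * T / real (2 ^ m) = real (2 * j) * T / real (2 ^ Suc m)" by simp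
    ultimately have "2 * j \<in> {..2 ^ Suc m}" "\<mu> < \<bar>I (real (2 * j) * T / real (2 ^ Suc m)) \<omega>\<bar>"
      by (simp, metis)
    then show "\<omega> \<in> A (Suc m)" using j(1) unfolding A_def by blast
  qed
  then have "incseq A" by (rule incseq_SucI)
  then have "(\<lambda>m. \<mu> * prob (A m)) \<longlonglongrightarrow> \<mu> * prob (\<Union>m. A m)"
    by (intro tendsto_intros finite_Lim_measure_incseq) auto
  then have "\<mu> * prob (\<Union>m. A m) \<le> sqrt (2 / pi) * L2_norm_on T f"
  proof (rule LIMSEQ_le_const2)
    have "\<mu> * prob (A m) \<le> sqrt (2 / pi) * L2_norm_on T f" for m
      unfolding A_def using stoch_integral_grid_maximal_inequality[OF bm I f \<open>0 < T\<close> \<open>0 < \<mu>\<close>, of "2 ^ m"] by simp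
    then show "\<exists>N. \<forall>m\<ge>N. \<mu> * prob (A m) \<le> sqrt (2 / pi) * L2_norm_on T f" by blast
  qed
  moreover have "\<bar>I t \<omega>\<bar> \<le> \<mu>"
    if "\<omega> \<in> space M" "continuous_on {0..} (\<lambda>t. I t \<omega>)" "\<omega> \<notin> (\<Union>m. A m)" "0 \<le> t" "t \<le> T" for \<omega> t
    using that(1,3) by (intro dyadic_bound_continuous[OF that(2) \<open>0 < T\<close> _ that(4,5)]) (force simp: A_def not_less)
  ultimately show ?thesis
    using A_sets by (intro bexI[of _ "\<Union>m. A m"] conjI ballI impI) auto
qed

section \<open>The probability bound\<close>

theorem theorem3p2:
  fixes M :: "'a measure" and B I1 I2 :: "real \<Rightarrow> 'a \<Rightarrow> real"
    and a c y \<sigma> \<kappa>1 \<kappa>2 T :: real and n :: nat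
    and x0 w1 w2 :: "real \<Rightarrow> real"
  assumes "prob_space M" and "complete_measure M" and "brownian_motion M B"
    and "c < 0" and "0 < a" and "2 * c + a < 0" and "c < - a - c" and "- a - c < a"
    and "y \<in> {c..- a - c}"
    and "\<sigma> > 0"
    and "x0 = x_zero a c y"
    and "\<kappa>1 \<noteq> 0" and "\<kappa>2 \<noteq> 0"
    and "w1 = w_one a c y \<kappa>1" and "w2 = w_two a c y \<kappa>2"
    and wronskian: "\<And>t. t \<ge> 0 \<Longrightarrow> w1 t * deriv w2 t - deriv w1 t * w2 t = 1"
    and "stoch_integral_process M B w1 I1" and "stoch_integral_process M B w2 I2"
    and "n \<ge> 1" and "T > 0"
  shows "measure M {\<omega> \<in> space M. \<forall>t\<in>{0..T}.
             \<bar>X_approx x0 w1 w2 I1 I2 \<sigma> n t \<omega> - x0 t\<bar> \<le> Gamma_sum w1 w2 n t}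
         \<ge> 1 - \<sigma> * 2 ^ (n - 1) * sqrt (2 / pi) * (L2_norm_on T w1 + L2_norm_on T w2)"
proof -
  interpret prob_space M by fact
  note bm = \<open>brownian_motion M B\<close>
  let ?E = "{\<omega> \<in> space M. \<forall>t\<in>{0..T}.
             \<bar>X_approx x0 w1 w2 I1 I2 \<sigma> n t \<omega> - x0 t\<bar> \<le> Gamma_sum w1 w2 n t}"
  have q: "0 \<le> modulus a c" "modulus a c < 1"
    using modulus_in_unit_interval assms(6,8) by blast+
  have w: "continuous_on UNIV w1" "continuous_on UNIV w2"
    unfolding \<open>w1 = _\<close> \<open>w2 = _\<close> by (rule continuous_on_w_one_w_two[OF q])+
  have I: "\<And>t. 0 \<le> t \<Longrightarrow> is_stoch_integral M B w1 t (I1 t)" "\<And>t. 0 \<le> t \<Longrightarrow> is_stoch_integral M B w2 t (I2 t)"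
    using assms(17,18) by (auto simp: stoch_integral_process_def)
  have meas: "\<And>t. 0 \<le> t \<Longrightarrow> I1 t \<in> borel_measurable M" "\<And>t. 0 \<le> t \<Longrightarrow> I2 t \<in> borel_measurable M"
    using I by (auto simp: is_stoch_integral_def)
  have "AE \<omega> in M. continuous_on {0..} (\<lambda>t. I1 t \<omega>) \<and> continuous_on {0..} (\<lambda>t. I2 t \<omega>)"
    using assms(17,18) by (auto simp: stoch_integral_process_def)
  then obtain Z where Z: "Z \<in> null_sets M" and
    cont: "\<And>\<omega>. \<omega> \<in> space M - Z \<Longrightarrow> continuous_on {0..} (\<lambda>t. I1 t \<omega>)"
      "\<And>\<omega>. \<omega> \<in> space M - Z \<Longrightarrow> continuous_on {0..} (\<lambda>t. I2 t \<omega>)"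
    by (auto elim!: AE_E3)
  have E: "?E \<in> events"
    using \<open>T > 0\<close> by (intro X_approx_event_measurable[OF assms(2) w meas Z cont]) auto
  have "0 < 1 / \<sigma>" using \<open>\<sigma> > 0\<close> by simp
  obtain A1 where A1: "A1 \<in> events" "1 / \<sigma> * prob A1 \<le> sqrt (2 / pi) * L2_norm_on T w1"
    "\<forall>\<omega>\<in>space M - A1. continuous_on {0..} (\<lambda>t. I1 t \<omega>) \<longrightarrow> (\<forall>t\<in>{0..T}. \<bar>I1 t \<omega>\<bar> \<le> 1 / \<sigma>)"
    using stoch_integral_maximal_inequality[OF bm I(1) w(1) \<open>T > 0\<close> \<open>0 < 1 / \<sigma>\<close>] by blast
  obtain A2 where A2: "A2 \<in> events" "1 / \<sigma> * prob A2 \<le> sqrt (2 / pi) * L2_norm_on T w2"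
    "\<forall>\<omega>\<in>space M - A2. continuous_on {0..} (\<lambda>t. I2 t \<omega>) \<longrightarrow> (\<forall>t\<in>{0..T}. \<bar>I2 t \<omega>\<bar> \<le> 1 / \<sigma>)"
    using stoch_integral_maximal_inequality[OF bm I(2) w(2) \<open>T > 0\<close> \<open>0 < 1 / \<sigma>\<close>] by blast
  have "space M - ?E \<subseteq> A1 \<union> A2 \<union> Z"
  proof
    fix \<omega> assume \<omega>: "\<omega> \<in> space M - ?E"
    show "\<omega> \<in> A1 \<union> A2 \<union> Z"
    proof (rule ccontr)
      assume n: "\<omega> \<notin> A1 \<union> A2 \<union> Z"
      have "\<bar>X_approx x0 w1 w2 I1 I2 \<sigma> n t \<omega> - x0 t\<bar> \<le> Gamma_sum w1 w2 n t" if "t \<in> {0..T}" for t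
        using that \<omega> n \<open>\<sigma> > 0\<close> A1(3) A2(3) cont
        by (intro X_approx_le_Gamma_sum[OF w, of T]) auto
      with \<omega> show False by blast
    qed
  qed
  then have "prob (space M - ?E) \<le> prob (A1 \<union> A2 \<union> Z)"
    using A1(1) A2(1) Z by (intro finite_measure_mono) auto
  also have "\<dots> \<le> prob (A1 \<union> A2) + prob Z"
    using A1(1) A2(1) Z by (intro measure_Un_le) auto
  also have "\<dots> = prob (A1 \<union> A2)" using measure_eq_0_null_sets[OF Z] by simp
  also have "\<dots> \<le> prob A1 + prob A2"
    using A1(1) A2(1) by (intro measure_Un_le) auto
  also have "\<dots> \<le> \<sigma> * (sqrt (2 / pi) * L2_norm_on T w1) + \<sigma> * (sqrt (2 / pi) * L2_norm_on T w2)"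
    using A1(2) A2(2) \<open>\<sigma> > 0\<close> by (intro add_mono) (simp_all add: field_simps)
  also have "\<dots> = 1 * (\<sigma> * sqrt (2 / pi) * (L2_norm_on T w1 + L2_norm_on T w2))"
    by (simp add: algebra_simps)
  also have "\<dots> \<le> 2 ^ (n - 1) * (\<sigma> * sqrt (2 / pi) * (L2_norm_on T w1 + L2_norm_on T w2))"
    using \<open>\<sigma> > 0\<close>
    by (intro mult_right_mono mult_nonneg_nonneg add_nonneg_nonneg)
      (auto simp: L2_norm_on_def set_lebesgue_integral_def)
  finally have "1 - prob ?E \<le> \<sigma> * 2 ^ (n - 1) * sqrt (2 / pi) * (L2_norm_on T w1 + L2_norm_on T w2)"
    unfolding prob_compl[OF E] by (simp add: mult_ac)
  then show ?thesis by simp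
qed

end
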